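(* Let $S$ be a signature and $\mathbb K$ a field. For any leaning $S$-forests $F_1$ and $F_2$, in the algebra $A$ (the natural Hopf algebra of the free nonsymmetric operad on $S$, equipped with its product), $$\mathbf F_{F_1}\cdot\mathbf F_{F_2}=\sum_{F}\mathbf F_F,$$ where the sum ranges over all leaning $S$-forests $F$ with $F_1\rhd F_2\preceq F\preceq F_1\lhd F_2$.
   Context: A signature is a set $S$ with arity map $|\cdot|:S\to\mathbb N$. An $S$-term is either the leaf $\ell$ or $s\,t_1\cdots t_{|s|}$ ($s\in S$, $t_i$ $S$-terms). Internal nodes are numbered $1,\dots,\deg t$ in preorder (root first, then subterms left to right); $\mathrm{dc}(t)$ is the word of decorations; children (leaves included) are numbered from $1$ left to right; node $i$ has parent edge $(\mathrm{pa}(i),\mathrm{lp}(i),i)$ (convention $\mathrm{pa}(1)=1,\mathrm{lp}(1)=0$); $\mathrm{cnc}(t)(i)=\mathrm{pa}(i)+1-2^{\mathrm{lp}(i)-a}$ with $a$ the arity of the decoration of $\mathrm{pa}(i)$; $t_1\preceq t_2$ iff $\mathrm{dc}(t_1)=\mathrm{dc}(t_2)$ and $\mathrm{cnc}(t_1)\le\mathrm{cnc}(t_2)$ componentwise. A leaf is extreme if all internal nodes are visited before it in preorder. $\mathrm{tlt}(\{1\})(t)$ reorders the children of the root so that non-leaf children keep their order and precede leaf children. Let $S_{\mathbb N}=S\sqcup\mathbb N$ with $n\in\mathbb N$ of arity $n$. An $S$-forest is an $S_{\mathbb N}$-term $n\,t_1\cdots t_n$ with $t_i$ $S$-terms; it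 is balanced if its degree is $n+1$, then its size is $n$; it is leaning if balanced and fixed by $\mathrm{tlt}(\{1\})$; forests are ordered by $\preceq$. Concatenation: $(n\,t_1\cdots t_n)\cdot(n'\,t'_1\cdots t'_{n'})=(n+n')\,t_1\cdots t_nt'_1\cdots t'_{n'}$. Over: $F_1\rhd F_2:=\mathrm{tlt}(\{1\})(F_1\cdot F_2)$. Under: if $F_1,F_2$ have sizes $n_1,n_2$ and $F_1$ has $r$ extreme leaves, $F_1\lhd F_2$ is obtained by grafting, for each $j\in[n_2+r]$, the $j$-th child subterm of the root of $F_2\cdot c(r)$ onto the $j$-th extreme leaf of $F_1\cdot c(n_2)$, where $c(k)=k\,\ell\cdots\ell$ ($k$ leaves). Let $A$ be the $\mathbb K$-vector space with basis $\{\mathbf E_F\}$ indexed by leaning $S$-forests, with associative product $\mathbf E_{F_1}\cdot\mathbf E_{F_2}=\mathbf E_{F_1\rhd F_2}$ (this is the algebra underlying the natural Hopf algebra of the free nonsymmetric operad on $S$, leaning forests encoding words of non-leaf $S$-terms). Define the fundamental basis by $\mathbf F_F:=\sum_{F'}\mu(F,F')\,\mathbf E_{F'}$ over leaning $F'$ with $F\preceq F'$, where $\mu$ is the Möbius function of the poset of leaning $S$-forests ordered by $\preceq$ (equivalently $\mathbf E_F=\sum_{F\preceq F'}\mathbf F_{F'}$). *)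

theory Defs
  imports Complex_Main "HOL-Library.Poly_Mapping"
begin

section \<open>Terms over a signature\<close>

text \<open>
  A signature is a carrier set together with an arity map; \<open>S\<close> is an explicit set (rather than
  a whole type) so that the empty signature is included.
\<close>

datatype 'a tm = Leaf | Node 'a "'a tm list"

inductive_set sterms :: "'a set \<Rightarrow> ('a \<Rightarrow> nat) \<Rightarrow> 'a tm set"
  for S :: "'a set" and ar :: "'a \<Rightarrow> nat" where
  Leaf: "Leaf \<in> sterms S ar"
| Node: "\<lbrakk>s \<in> S; length ts = ar s; \<forall>t\<in>set ts. t \<in> sterms S ar\<rbrakk> \<Longrightarrow> Node s ts \<in> sterms S ar"

fun dc :: "'a tm \<Rightarrow> 'a list" where
  "dc Leaf = []"
| "dc (Node s ts) = s # List.concat (map dc ts)"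

definition deg :: "'a tm \<Rightarrow> nat" where
  "deg t = length (dc t)"

text \<open>
  \<open>edges_from n p l t\<close> lists in preorder the pairs (parent, local position) of the internal
  nodes of \<open>t\<close>, when \<open>t\<close> is the \<open>l\<close>-th child of node \<open>p\<close> and its first internal node
  is numbered \<open>n\<close>.  All numbers are 1-based.  Calling it with \<open>p = 1\<close> and \<open>l = 0\<close> yields the
  convention \<open>pa(1) = 1\<close>, \<open>lp(1) = 0\<close> for the root.
\<close>

fun edges_from :: "nat \<Rightarrow> nat \<Rightarrow> nat \<Rightarrow> 'a tm \<Rightarrow> (nat \<times> nat) list"
  and child_edges_from :: "nat \<Rightarrow> nat \<Rightarrow> nat \<Rightarrow> 'a tm list \<Rightarrow> (nat \<times> nat) list" where
  "edges_from n p l Leaf = []"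
| "edges_from n p l (Node s ts) = (p, l) # child_edges_from (n + 1) n 1 ts"
| "child_edges_from n p l [] = []"
| "child_edges_from n p l (t # ts) =
     edges_from n p l t @ child_edges_from (n + deg t) p (l + 1) ts"

definition parent_edges :: "'a tm \<Rightarrow> (nat \<times> nat) list" where
  "parent_edges t = edges_from 1 1 0 t"

definition pa :: "'a tm \<Rightarrow> nat \<Rightarrow> nat" where
  "pa t i = fst (parent_edges t ! (i - 1))"

definition lp :: "'a tm \<Rightarrow> nat \<Rightarrow> nat" where
  "lp t i = snd (parent_edges t ! (i - 1))"

definition cnc :: "('a \<Rightarrow> nat) \<Rightarrow> 'a tm \<Rightarrow> nat \<Rightarrow> rat" where
  "cnc ar t i =
     of_nat (pa t i) + 1 - 2 powi (int (lp t i) - int (ar (dc t ! (pa t i - 1))))"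

definition tm_le :: "('a \<Rightarrow> nat) \<Rightarrow> 'a tm \<Rightarrow> 'a tm \<Rightarrow> bool" where
  "tm_le ar t1 t2 \<longleftrightarrow> dc t1 = dc t2 \<and> (\<forall>i\<in>{1..deg t1}. cnc ar t1 i \<le> cnc ar t2 i)"

text \<open>The operation \<open>tlt({1})\<close>.\<close>

fun tlt_root :: "'a tm \<Rightarrow> 'a tm" where
  "tlt_root Leaf = Leaf"
| "tlt_root (Node s ts) = Node s (filter (\<lambda>t. t \<noteq> Leaf) ts @ filter (\<lambda>t. t = Leaf) ts)"

section \<open>Extreme leaves and grafting\<close>

text \<open>
  Preorder word of all nodes, leaves (\<open>None\<close>) included; positions in it are 0-based and serve
  to identify leaves.
\<close>

fun preorder :: "'a tm \<Rightarrow> 'a option list" where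
  "preorder Leaf = [None]"
| "preorder (Node s ts) = Some s # List.concat (map preorder ts)"

definition extreme_leaves :: "'a tm \<Rightarrow> nat set" where
  "extreme_leaves t =
     {p. p < length (preorder t) \<and> preorder t ! p = None \<and>
         (\<forall>q < length (preorder t). preorder t ! q \<noteq> None \<longrightarrow> q < p)}"

text \<open>
  \<open>subst_leaves g p t\<close> replaces each leaf of \<open>t\<close> by \<open>g q\<close>, where \<open>q\<close> is the position of that
  leaf and the root of \<open>t\<close> has position \<open>p\<close>.
\<close>

fun subst_leaves :: "(nat \<Rightarrow> 'a tm) \<Rightarrow> nat \<Rightarrow> 'a tm \<Rightarrow> 'a tm"
  and subst_leaves_list :: "(nat \<Rightarrow> 'a tm) \<Rightarrow> nat \<Rightarrow> 'a tm list \<Rightarrow> 'a tm list" where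
  "subst_leaves g p Leaf = g p"
| "subst_leaves g p (Node s ts) = Node s (subst_leaves_list g (p + 1) ts)"
| "subst_leaves_list g p [] = []"
| "subst_leaves_list g p (t # ts) =
     subst_leaves g p t # subst_leaves_list g (p + length (preorder t)) ts"

text \<open>
  Grafts the successive terms of \<open>us\<close> onto the successive extreme leaves of \<open>t\<close>; meant for
  \<open>length us = card (extreme_leaves t)\<close>.
\<close>

definition graft_extreme :: "'a tm list \<Rightarrow> 'a tm \<Rightarrow> 'a tm" where
  "graft_extreme us t =
     subst_leaves
       (\<lambda>p. if p \<in> extreme_leaves t then us ! card {q \<in> extreme_leaves t. q < p} else Leaf) 0 t"

section \<open>Forests\<close>

text \<open>
  The signature \<open>S\<^sub>\<nat>\<close> has carrier \<open>S <+> UNIV\<close>; its subset \<open>Inl ` S\<close> is the copy of \<open>S\<close>.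
\<close>

definition arN :: "('s \<Rightarrow> nat) \<Rightarrow> 's + nat \<Rightarrow> nat" where
  "arN ar = case_sum ar id"

definition forests :: "'s set \<Rightarrow> ('s \<Rightarrow> nat) \<Rightarrow> ('s + nat) tm set" where
  "forests S ar =
     {Node (Inr n) ts | n ts. length ts = n \<and> set ts \<subseteq> sterms (Inl ` S) (arN ar)}"

fun children :: "'a tm \<Rightarrow> 'a tm list" where
  "children Leaf = []"
| "children (Node s ts) = ts"

definition balanced :: "'s set \<Rightarrow> ('s \<Rightarrow> nat) \<Rightarrow> ('s + nat) tm set" where
  "balanced S ar = {F \<in> forests S ar. deg F = length (children F) + 1}"

definition leaning :: "'s set \<Rightarrow> ('s \<Rightarrow> nat) \<Rightarrow> ('s + nat) tm set" where
  "leaning S ar = {F \<in> balanced S ar. tlt_root F = F}"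

text \<open>The size of a balanced forest, that is, the number of children of its root.\<close>

definition fsize :: "('s + nat) tm \<Rightarrow> nat" where
  "fsize F = length (children F)"

text \<open>Concatenation is only specified on forests.\<close>

fun fconcat :: "('s + nat) tm \<Rightarrow> ('s + nat) tm \<Rightarrow> ('s + nat) tm" where
  "fconcat (Node (Inr n) ts) (Node (Inr m) us) = Node (Inr (n + m)) (ts @ us)"

definition corolla :: "nat \<Rightarrow> ('s + nat) tm" where
  "corolla k = Node (Inr k) (replicate k Leaf)"

definition forest_over :: "('s + nat) tm \<Rightarrow> ('s + nat) tm \<Rightarrow> ('s + nat) tm" where
  "forest_over F1 F2 = tlt_root (fconcat F1 F2)"

definition forest_under :: "('s + nat) tm \<Rightarrow> ('s + nat) tm \<Rightarrow> ('s + nat) tm" where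
  "forest_under F1 F2 =
     (let r = card (extreme_leaves F1)
      in graft_extreme (children (fconcat F2 (corolla r))) (fconcat F1 (corolla (fsize F2))))"

abbreviation forest_le :: "('s \<Rightarrow> nat) \<Rightarrow> ('s + nat) tm \<Rightarrow> ('s + nat) tm \<Rightarrow> bool" where
  "forest_le ar \<equiv> tm_le (arN ar)"

section \<open>Moebius function of a locally finite poset\<close>

definition interval :: "'a set \<Rightarrow> ('a \<times> 'a) set \<Rightarrow> 'a \<Rightarrow> 'a \<Rightarrow> 'a set" where
  "interval P r x z = {y \<in> P. (x, y) \<in> r \<and> (y, z) \<in> r}"

definition locally_finite_poset :: "'a set \<Rightarrow> ('a \<times> 'a) set \<Rightarrow> bool" where
  "locally_finite_poset P r \<longleftrightarrow>
     partial_order_on P r \<and> (\<forall>x\<in>P. \<forall>z\<in>P. finite (interval P r x z))"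

text \<open>
  The usual recursion \<open>\<mu>(x,x) = 1\<close> and \<open>\<mu>(x,z) = - (\<Sum>x \<le> y < z. \<mu>(x,y))\<close> for \<open>x < z\<close>.  The first
  guard is there for termination only: it holds for the posets of interest.
\<close>

function moebius :: "'a set \<Rightarrow> ('a \<times> 'a) set \<Rightarrow> 'a \<Rightarrow> 'a \<Rightarrow> int" where
  "moebius P r x z =
     (if locally_finite_poset P r \<and> x \<in> P \<and> z \<in> P \<and> (x, z) \<in> r
      then if x = z then 1 else - (\<Sum>y\<in>interval P r x z - {z}. moebius P r x y)
      else 0)"
  by pat_completeness auto
termination
proof (relation "Wellfounded.measure (\<lambda>(P, r, x, z). card (interval P r x z))", goal_cases)
  case 1
  show ?case by simp
next
  case (2 P r x z y)
  from 2 have po: "antisym r" "trans r" and fin: "finite (interval P r x z)"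
    by (auto simp: locally_finite_poset_def partial_order_on_def preorder_on_def)
  from 2 have y: "y \<in> P" "(x, y) \<in> r" "(y, z) \<in> r" "y \<noteq> z"
    by (auto simp: interval_def)
  from y po have sub: "interval P r x y \<subseteq> interval P r x z"
    by (auto simp: interval_def dest: transD)
  from y po have "z \<notin> interval P r x y"
    by (auto simp: interval_def dest: antisymD)
  moreover from 2 have "z \<in> interval P r x z"
    by (auto simp: interval_def locally_finite_poset_def partial_order_on_def preorder_on_def
             dest: refl_onD)
  ultimately have "interval P r x y \<subset> interval P r x z" using sub by blast
  with fin show ?case by (simp add: psubset_card_mono)
qed

declare moebius.simps [simp del]

definition leaning_rel ::
  "'s set \<Rightarrow> ('s \<Rightarrow> nat) \<Rightarrow> (('s + nat) tm \<times> ('s + nat) tm) set" where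
  "leaning_rel S ar =
     {(F, G). F \<in> leaning S ar \<and> G \<in> leaning S ar \<and> forest_le ar F G}"

section \<open>The algebra\<close>

text \<open>
  Elements of the algebra are the finitely supported functions on forests whose support (\<open>keys\<close>)
  consists of leaning forests.  The product is the bilinear extension of \<open>forest_over\<close>.
\<close>

definition scale :: "'k::field \<Rightarrow> ('b \<Rightarrow>\<^sub>0 'k) \<Rightarrow> 'b \<Rightarrow>\<^sub>0 'k" where
  "scale c x = Poly_Mapping.map (\<lambda>a. c * a) x"

definition E_basis :: "('s + nat) tm \<Rightarrow> ('s + nat) tm \<Rightarrow>\<^sub>0 'k::field" where
  "E_basis F = Poly_Mapping.single F 1"

definition A_mult ::
  "(('s + nat) tm \<Rightarrow>\<^sub>0 'k::field) \<Rightarrow> (('s + nat) tm \<Rightarrow>\<^sub>0 'k) \<Rightarrow> ('s + nat) tm \<Rightarrow>\<^sub>0 'k" where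
  "A_mult x y =
     (\<Sum>F1\<in>Poly_Mapping.keys x. \<Sum>F2\<in>Poly_Mapping.keys y.
        scale (Poly_Mapping.lookup x F1 * Poly_Mapping.lookup y F2) (E_basis (forest_over F1 F2)))"

definition F_basis ::
  "'s set \<Rightarrow> ('s \<Rightarrow> nat) \<Rightarrow> ('s + nat) tm \<Rightarrow> ('s + nat) tm \<Rightarrow>\<^sub>0 'k::field" where
  "F_basis S ar F =
     (\<Sum>F'\<in>{F' \<in> leaning S ar. forest_le ar F F'}.
        scale (of_int (moebius (leaning S ar) (leaning_rel S ar) F F')) (E_basis F'))"

end

theory Submission
  imports Defs "HOL-Library.Sublist"
begin

text \<open>
  A leaning forest is determined by the word of its non-leaf trees, and \<open>\<rhd>\<close> becomes concatenation
  of words.  In the order only the non-root edges matter, because the local positions of the roots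
  are determined by which nodes are roots.  Let \<open>w\<close> be a word whose decorations are those of \<open>u\<close>
  followed by those of \<open>v\<close>.  Cutting \<open>w\<close> after the nodes coming from \<open>u\<close> gives an initial part
  and a tail, and \<open>u v\<close> lies below \<open>w\<close> iff \<open>u\<close> and \<open>v\<close> lie below these two parts.  Expanding
  both factors in the \<open>E\<close> basis and the product back in the \<open>F\<close> basis, the two Moebius sums that
  form the coefficient of \<open>w\<close> therefore collapse: the coefficient is 1 if the parts of \<open>w\<close> are
  exactly \<open>u\<close> and \<open>v\<close>, and 0 otherwise.  Finally, the words with parts \<open>u\<close> and \<open>v\<close> form the
  interval from over to under, since grafting on the first extreme leaves is the greatest way
  of attaching \<open>v\<close> below \<open>u\<close>.
\<close>

section \<open>Terms and their edges\<close>

abbreviation dcs :: "'a tm list \<Rightarrow> 'a list" where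
  "dcs ts \<equiv> List.concat (map dc ts)"

abbreviation degs :: "'a tm list \<Rightarrow> nat" where
  "degs ts \<equiv> length (dcs ts)"

abbreviation nonleaf :: "'a tm list \<Rightarrow> 'a tm list" where
  "nonleaf ts \<equiv> filter (\<lambda>t. t \<noteq> Leaf) ts"

lemma Leaf_in_sterms [simp]: "Leaf \<in> sterms S ar"
  by (rule sterms.Leaf)

lemma Node_in_sterms_iff [simp]:
  "Node s ts \<in> sterms S ar \<longleftrightarrow> s \<in> S \<and> length ts = ar s \<and> set ts \<subseteq> sterms S ar"
  by (subst sterms.simps) auto

lemma deg_simps [simp]:
  "deg Leaf = 0" "deg (Node s ts) = Suc (degs ts)"
  by (simp_all add: deg_def)

lemma length_dc [simp]: "length (dc t) = deg t"
  by (simp add: deg_def)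

lemma dcs_nonleaf [simp]: "dcs (nonleaf ts) = dcs ts"
  by (induction ts) auto

lemma dcs_replicate_Leaf [simp]: "dcs (replicate m Leaf) = []"
  by (induction m) auto

lemma length_nonleaf_le_degs: "length (nonleaf ts) \<le> degs ts"
proof (induction ts)
  case (Cons t ts)
  then show ?case by (cases t) auto
qed simp

lemma
  fixes t :: "'a tm" and ts :: "'a tm list"
  shows length_edges_from [simp]: "length (edges_from n p l t) = deg t"
  and length_child_edges_from [simp]: "length (child_edges_from n p l ts) = degs ts"
  by (induction n p l t and n p l ts rule: edges_from_child_edges_from.induct) auto

lemma child_edges_from_append:
  "child_edges_from n p l (ts @ us) =
     child_edges_from n p l ts @ child_edges_from (n + degs ts) p (l + length ts) us"
  by (induction ts arbitrary: n l) (auto simp: add_ac)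

lemma child_edges_from_replicate_Leaf [simp]:
  "child_edges_from n p l (replicate m Leaf) = []"
  by (induction m arbitrary: l) auto

text \<open>Parents are the outside node \<open>p\<close> or numbered from \<open>n\<close> on, so
  for \<open>p < n\<close> root edges can be told from inner ones.\<close>

lemma
  fixes t :: "'a tm" and ts :: "'a tm list"
  shows edges_from_bounds:
  "e \<in> set (edges_from n p l t) \<Longrightarrow> e = (p, l) \<or> n \<le> fst e"
  and child_edges_from_bounds:
  "e \<in> set (child_edges_from n p l ts) \<Longrightarrow> fst e = p \<and> l \<le> snd e \<or> n \<le> fst e"
  by (induction n p l t and n p l ts rule: edges_from_child_edges_from.induct) fastforce+

text \<open>The arity bound keeps the exponent in \<open>cnc\<close> at most 0; later it also bounds
  the number of words with given decorations.\<close>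

lemma
  fixes t :: "'a tm" and ts :: "'a tm list"
  shows edges_from_arity:
  "t \<in> sterms S ar \<Longrightarrow> e \<in> set (edges_from n p l t) \<Longrightarrow>
     e = (p, l) \<or>
     n \<le> fst e \<and> fst e < n + deg t \<and> 1 \<le> snd e \<and> snd e \<le> ar (dc t ! (fst e - n))"
  and child_edges_from_arity:
  "set ts \<subseteq> sterms S ar \<Longrightarrow> e \<in> set (child_edges_from n p l ts) \<Longrightarrow>
     fst e = p \<and> l \<le> snd e \<and> snd e < l + length ts \<or>
     n \<le> fst e \<and> fst e < n + degs ts \<and> 1 \<le> snd e \<and> snd e \<le> ar (dcs ts ! (fst e - n))"
proof (induction n p l t and n p l ts rule: edges_from_child_edges_from.induct)
  case (2 n p l s ts)
  from "2.prems"(1) have s: "set ts \<subseteq> sterms S ar" "length ts = ar s"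
    by auto
  from "2.prems"(2) consider "e = (p, l)" | "e \<in> set (child_edges_from (n + 1) n 1 ts)" by auto
  then show ?case
  proof cases
    case 2
    with "2.IH" s have "fst e = n \<and> 1 \<le> snd e \<and> snd e < 1 + length ts \<or>
      n + 1 \<le> fst e \<and> fst e < n + 1 + degs ts \<and> 1 \<le> snd e \<and>
      snd e \<le> ar (dcs ts ! (fst e - (n + 1)))" by blast
    then show ?thesis using s(2) by (auto simp: nth_Cons')
  qed simp
next
  case (4 n p l t ts)
  from "4.prems"(2) consider "e \<in> set (edges_from n p l t)"
    | "e \<in> set (child_edges_from (n + deg t) p (l + 1) ts)" by auto
  then show ?case
  proof cases
    case 1
    with "4.IH"(1) "4.prems"(1) show ?thesis by (fastforce simp: nth_append)
  next
    case 2
    with "4.IH"(2) "4.prems"(1) show ?thesis by (fastforce simp: nth_append)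
  qed
qed auto

section \<open>Comparing terms edge by edge\<close>

definition shift :: "nat \<Rightarrow> nat \<times> nat \<Rightarrow> nat \<times> nat" where
  "shift d e = (fst e + d, snd e)"

lemma
  fixes t :: "'a tm" and ts :: "'a tm list"
  shows edges_from_shift:
  "edges_from (n + d) (p + d) l t = map (shift d) (edges_from n p l t)"
  and child_edges_from_shift:
  "child_edges_from (n + d) (p + d) l ts = map (shift d) (child_edges_from n p l ts)"
proof (induction n p l t and n p l ts rule: edges_from_child_edges_from.induct)
  case (4 n p l t ts)
  then show ?case by (simp add: ac_simps)
qed (auto simp: shift_def)

text \<open>Lexicographic with local positions reversed: the order that \<open>cnc\<close> induces
  on parent edges, since a larger position lowers \<open>cnc\<close>.\<close>

definition edge_le :: "nat \<times> nat \<Rightarrow> nat \<times> nat \<Rightarrow> bool" where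
  "edge_le e e' \<longleftrightarrow> fst e < fst e' \<or> fst e = fst e' \<and> snd e' \<le> snd e"

lemma edge_le_refl [simp]: "edge_le e e"
  by (simp add: edge_le_def)

lemma edge_le_shift_iff [simp]: "edge_le (shift d e) (shift d e') \<longleftrightarrow> edge_le e e'"
  by (auto simp: edge_le_def shift_def)

lemma edge_le_trans: "edge_le a b \<Longrightarrow> edge_le b c \<Longrightarrow> edge_le a c"
  by (auto simp: edge_le_def)

lemma edge_le_antisym: "edge_le a b \<Longrightarrow> edge_le b a \<Longrightarrow> a = b"
  by (auto simp: edge_le_def prod_eq_iff)

lemma edges_le_trans:
  "list_all2 edge_le xs ys \<Longrightarrow> list_all2 edge_le ys zs \<Longrightarrow> list_all2 edge_le xs zs"
  by (rule list_all2_trans[OF edge_le_trans])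

lemma edges_le_antisym: "list_all2 edge_le xs ys \<Longrightarrow> list_all2 edge_le ys xs \<Longrightarrow> xs = ys"
  by (rule list_all2_antisym[OF edge_le_antisym])

text \<open>The powers lie in (0, 1], so the two sides lie in [q, q + 1) and [q', q' + 1), and
  different parents already decide. For equal parents the arities agree and the power is strictly
  increasing in the position.\<close>

lemma cnc_le_iff_edge_le:
  fixes q q' m m' :: nat and a a' :: nat
  assumes "m \<le> a" "m' \<le> a'" "q = q' \<Longrightarrow> a = a'"
  shows "(of_nat q + 1 - 2 powi (int m - int a) :: rat) \<le> of_nat q' + 1 - 2 powi (int m' - int a')
    \<longleftrightarrow> edge_le (q, m) (q', m')"
proof -
  define x :: rat where "x = 2 powi (int m - int a)"
  define x' :: rat where "x' = 2 powi (int m' - int a')"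
  have x: "0 < x" "x \<le> 1" "0 < x'" "x' \<le> 1"
    using assms(1,2) power_int_increasing[of "int m - int a" 0 "2 :: rat"]
      power_int_increasing[of "int m' - int a'" 0 "2 :: rat"]
    by (auto simp: x_def x'_def)
  consider "q < q'" | "q' < q" | "q = q'" by linarith
  then show ?thesis
  proof cases
    case 1
    then have "(of_nat q + 1 :: rat) \<le> of_nat q'"
      by (metis Suc_eq_plus1 Suc_leI of_nat_1 of_nat_add of_nat_le_iff)
    with 1 x show ?thesis by (auto simp: edge_le_def simp flip: x_def x'_def)
  next
    case 2
    then have "(of_nat q' + 1 :: rat) \<le> of_nat q"
      by (metis Suc_eq_plus1 Suc_leI of_nat_1 of_nat_add of_nat_le_iff)
    with 2 x show ?thesis by (auto simp: edge_le_def simp flip: x_def x'_def)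
  next
    case 3
    have "x' \<le> x \<longleftrightarrow> m' \<le> m"
    proof
      assume "m' \<le> m"
      then show "x' \<le> x" unfolding x_def x'_def using assms(3)[OF 3]
        by (intro power_int_increasing) auto
    next
      assume "x' \<le> x"
      show "m' \<le> m"
      proof (rule ccontr)
        assume "\<not> m' \<le> m"
        then have "x < x'" unfolding x_def x'_def using assms(3)[OF 3]
          by (intro power_int_strict_increasing) auto
        with \<open>x' \<le> x\<close> show False by simp
      qed
    qed
    with 3 show ?thesis by (auto simp: edge_le_def simp flip: x_def x'_def)
  qed
qed

lemma tm_le_Node_iff:
  assumes "Node s ts \<in> sterms S ar" "Node s' ts' \<in> sterms S ar"
  shows "tm_le ar (Node s ts) (Node s' ts') \<longleftrightarrow>
    s = s' \<and> dcs ts = dcs ts' \<and>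
    list_all2 edge_le (child_edges_from 1 0 1 ts) (child_edges_from 1 0 1 ts')"
proof (cases "s = s' \<and> dcs ts = dcs ts'")
  case True
  define E where "E = child_edges_from 2 1 1 ts"
  define E' where "E' = child_edges_from 2 1 1 ts'"
  define D where "D = s # dcs ts"
  from True have len: "length E = degs ts" "length E' = degs ts" by (simp_all add: E_def E'_def)
  have ar: "snd (E ! i) \<le> ar (D ! (fst (E ! i) - 1)) \<and>
    snd (E' ! i) \<le> ar (D ! (fst (E' ! i) - 1))" if "i < degs ts" for i
  proof -
    from assms have *: "set ts \<subseteq> sterms S ar" "length ts = ar s" "set ts' \<subseteq> sterms S ar"
      "length ts' = ar s'" by auto
    have "E ! i \<in> set E" "E' ! i \<in> set E'" using that len by auto
    then show ?thesis using True child_edges_from_arity[OF *(1), of "E ! i" 2 1 1]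
        child_edges_from_arity[OF *(3), of "E' ! i" 2 1 1] *(2,4)
      by (auto simp: E_def E'_def D_def nth_Cons' numeral_2_eq_2)
  qed
  \<comment> \<open>\<open>E\<close> is 0-based and omits the root, so its entry \<open>i\<close>
    belongs to node \<open>i + 2\<close>.\<close>
  have step: "cnc ar (Node s ts) (i + 2) \<le> cnc ar (Node s' ts') (i + 2) \<longleftrightarrow>
    edge_le (E ! i) (E' ! i)" if "i < degs ts" for i
    using cnc_le_iff_edge_le[of "snd (E ! i)" "ar (D ! (fst (E ! i) - 1))" "snd (E' ! i)"
        "ar (D ! (fst (E' ! i) - 1))" "fst (E ! i)" "fst (E' ! i)"] ar[OF that] True
    by (simp add: cnc_def pa_def lp_def parent_edges_def D_def E_def E'_def numeral_2_eq_2)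
  have one: "cnc ar (Node s ts) (Suc 0) = cnc ar (Node s' ts') (Suc 0)"
    using True by (simp add: cnc_def pa_def lp_def parent_edges_def)
  have "(\<forall>i\<in>{1..deg (Node s ts)}. cnc ar (Node s ts) i \<le> cnc ar (Node s' ts') i) \<longleftrightarrow>
    (\<forall>i<degs ts. edge_le (E ! i) (E' ! i))" (is "?L \<longleftrightarrow> ?R")
  proof
    assume L: ?L
    show ?R
    proof (intro allI impI)
      fix i assume i: "i < degs ts"
      then have "i + 2 \<in> {1..deg (Node s ts)}" by simp
      with L step[OF i] show "edge_le (E ! i) (E' ! i)" by blast
    qed
  next
    assume R: ?R
    show ?L
    proof
      fix i assume i: "i \<in> {1..deg (Node s ts)}"
      show "cnc ar (Node s ts) i \<le> cnc ar (Node s' ts') i"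
      proof (cases "i = 1")
        case False
        with i have "i - 2 < degs ts" "i = i - 2 + 2" by auto
        with R step[of "i - 2"] show ?thesis by simp
      qed (simp add: one)
    qed
  qed
  also have "\<dots> \<longleftrightarrow> list_all2 edge_le E E'"
    using len by (auto simp: list_all2_conv_all_nth)
  \<comment> \<open>Renumbering by 1 gives the root the number 0, the numbering used for
    words.\<close>
  also have "\<dots> \<longleftrightarrow> list_all2 edge_le (child_edges_from 1 0 1 ts) (child_edges_from 1 0 1 ts')"
    using child_edges_from_shift[of 1 1 0 1 ts] child_edges_from_shift[of 1 1 0 1 ts']
    by (simp add: E_def E'_def list_all2_map1 list_all2_map2 numeral_2_eq_2)
  finally show ?thesis using True by (simp add: tm_le_def)
qed (auto simp: tm_le_def)

text \<open>Trees can be read off one by one. A leading leaf is recognised by the absence of the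
  edge \<open>(p, l)\<close>; otherwise the nodes of the first tree end where the next edge with
  parent \<open>p\<close> starts.\<close>

lemma child_edges_from_inject:
  assumes "set ts \<subseteq> sterms S ar" "set us \<subseteq> sterms S ar" "length ts = length us"
    and "dcs ts = dcs us" "child_edges_from n p l ts = child_edges_from n p l us" "p < n"
  shows "ts = us"
  using assms
proof (induction "size_list size ts" arbitrary: ts us n p l rule: less_induct)
  case less
  show ?case
  proof (cases ts)
    case Nil
    with less.prems show ?thesis by simp
  next
    case (Cons t ts')
    with less.prems(3) obtain u us' where us: "us = u # us'" by (cases us) auto
    have neq: "(p, l) \<noteq> e" if "e \<in> set (child_edges_from n p (l + 1) vs)" for e vs
      using child_edges_from_bounds[OF that] less.prems(6) by auto
    show ?thesis
    proof (cases t)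
      case Leaf
      have "u = Leaf"
      proof (cases u)
        case (Node s xs)
        then have "(p, l) \<in> set (child_edges_from n p l us)" by (simp add: us)
        with less.prems(5) Cons Leaf have "(p, l) \<in> set (child_edges_from n p (l + 1) ts')" by simp
        with neq show ?thesis by blast
      qed
      with less.hyps[of ts' us' n p "l + 1"] less.prems Cons us Leaf show ?thesis by simp
    next
      case (Node s xs)
      have "\<exists>s' ys. u = Node s' ys"
      proof (cases u)
        case Leaf
        have "(p, l) \<in> set (child_edges_from n p l ts)" using Cons Node by simp
        with less.prems(5) us Leaf have "(p, l) \<in> set (child_edges_from n p (l + 1) us')" by simp
        with neq show ?thesis by blast
      qed simp
      then obtain s' ys where u: "u = Node s' ys" by blast
      with less.prems(4) Cons Node us have s: "s' = s" and d: "dcs xs @ dcs ts' = dcs ys @ dcs us'"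
        by auto
      from less.prems(5) have e: "child_edges_from (n + 1) n 1 xs @
          child_edges_from (n + Suc (degs xs)) p (l + 1) ts' =
        child_edges_from (n + 1) n 1 ys @ child_edges_from (n + Suc (degs ys)) p (l + 1) us'"
        by (simp add: Cons us Node u)
      \<comment> \<open>Inner edges of the first tree have parents at least \<open>n\<close>,
        whereas the edges of the remaining trees, if any, start with a root edge.\<close>
      have tw: "takeWhile (\<lambda>e. fst e \<noteq> p) (child_edges_from (n + 1) n 1 zs @
          child_edges_from m p (l + 1) vs) = child_edges_from (n + 1) n 1 zs" for m zs vs
      proof -
        have "\<forall>e\<in>set (child_edges_from (n + 1) n 1 zs). fst e \<noteq> p"
          using child_edges_from_bounds[of _ "n + 1" n 1 zs] less.prems(6) by fastforce
        moreover have "takeWhile (\<lambda>e. fst e \<noteq> p) (child_edges_from m p k vs) = []" for k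
        proof (induction vs arbitrary: k)
          case (Cons v vs)
          then show ?case by (cases v) auto
        qed simp
        ultimately show ?thesis by (simp add: takeWhile_append2)
      qed
      have ex: "child_edges_from (n + 1) n 1 xs = child_edges_from (n + 1) n 1 ys"
        using e by (metis tw)
      then have "degs xs = degs ys" by (metis length_child_edges_from)
      with d e ex have *: "dcs xs = dcs ys" "dcs ts' = dcs us'"
        "child_edges_from (n + Suc (degs xs)) p (l + 1) ts' =
         child_edges_from (n + Suc (degs xs)) p (l + 1) us'" by auto
      have wf: "set xs \<subseteq> sterms S ar" "set ys \<subseteq> sterms S ar" "length xs = ar s" "length ys = ar s"
        using less.prems(1,2) Cons us Node u s by auto
      have "xs = ys"
        using less.hyps[of xs ys "n + 1" n 1] wf *(1) ex Cons Node by simp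
      moreover have "ts' = us'"
        using less.hyps[of ts' us' "n + Suc (degs xs)" p "l + 1"] less.prems * Cons us Node by auto
      ultimately show ?thesis using Cons us Node u s by simp
    qed
  qed
qed

section \<open>Cutting terms and the order on words\<close>

text \<open>Both functions cut after the first \<open>k\<close> internal nodes in preorder: \<open>prune\<close> keeps what comes
  before the cut, \<open>cut_terms\<close> collects the subterms, leaves included, that hang below it.  The
  truncated subtraction \<open>k - deg t\<close> is \<open>0\<close> as soon as the cut has been passed.\<close>

fun prune :: "nat \<Rightarrow> 'a tm \<Rightarrow> 'a tm"
  and prune_list :: "nat \<Rightarrow> 'a tm list \<Rightarrow> 'a tm list" where
  "prune 0 t = Leaf"
| "prune (Suc k) Leaf = Leaf"
| "prune (Suc k) (Node s ts) = Node s (prune_list k ts)"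
| "prune_list k [] = []"
| "prune_list k (t # ts) = prune k t # prune_list (k - deg t) ts"

fun cut_terms :: "nat \<Rightarrow> 'a tm \<Rightarrow> 'a tm list"
  and cut_terms_list :: "nat \<Rightarrow> 'a tm list \<Rightarrow> 'a tm list" where
  "cut_terms 0 t = [t]"
| "cut_terms (Suc k) Leaf = []"
| "cut_terms (Suc k) (Node s ts) = cut_terms_list k ts"
| "cut_terms_list k [] = []"
| "cut_terms_list k (t # ts) = cut_terms k t @ cut_terms_list (k - deg t) ts"

lemma prune_Leaf [simp]: "prune k Leaf = Leaf"
  by (cases k) auto

lemma length_prune_list [simp]: "length (prune_list k ts) = length ts"
  by (induction ts arbitrary: k) auto

lemma prune_list_append:
  "prune_list k (ts @ us) = prune_list k ts @ prune_list (k - degs ts) us"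
  by (induction ts arbitrary: k) auto

lemma prune_list_replicate_Leaf [simp]: "prune_list k (replicate m Leaf) = replicate m Leaf"
  by (induction m arbitrary: k) auto

lemma prune_list_0 [simp]: "prune_list 0 ts = replicate (length ts) Leaf"
  by (induction ts) auto

lemma cut_terms_list_0 [simp]: "cut_terms_list 0 ts = ts"
  by (induction ts) auto

lemma cut_terms_list_append:
  "cut_terms_list k (ts @ us) = cut_terms_list k ts @ cut_terms_list (k - degs ts) us"
  by (induction ts arbitrary: k) auto

lemma nonleaf_cut_terms_list_replicate_Leaf [simp]:
  "nonleaf (cut_terms_list k (replicate m Leaf)) = []"
  by (cases k) (induction m, auto)+

lemma
  fixes t :: "'a tm" and ts :: "'a tm list"
  shows dc_prune [simp]: "dc (prune k t) = take k (dc t)"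
    and dcs_prune_list [simp]: "dcs (prune_list k ts) = take k (dcs ts)"
  by (induction k t and k ts rule: prune_prune_list.induct) auto

lemma deg_prune [simp]: "deg (prune k t) = min k (deg t)"
  by (metis dc_prune length_dc length_take min.commute)

lemma
  fixes t :: "'a tm" and ts :: "'a tm list"
  shows dcs_cut_terms [simp]: "dcs (cut_terms k t) = drop k (dc t)"
    and dcs_cut_terms_list [simp]: "dcs (cut_terms_list k ts) = drop k (dcs ts)"
  by (induction k t and k ts rule: cut_terms_cut_terms_list.induct) auto

lemma
  fixes t :: "'a tm" and ts :: "'a tm list"
  shows prune_in_sterms: "t \<in> sterms S ar \<Longrightarrow> prune k t \<in> sterms S ar"
    and prune_list_in_sterms: "set ts \<subseteq> sterms S ar \<Longrightarrow> set (prune_list k ts) \<subseteq> sterms S ar"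
proof (induction k t and k ts rule: prune_prune_list.induct)
  case (3 k s ts)
  then show ?case by simp
qed auto

lemma
  fixes t :: "'a tm" and ts :: "'a tm list"
  shows cut_terms_in_sterms: "t \<in> sterms S ar \<Longrightarrow> set (cut_terms k t) \<subseteq> sterms S ar"
    and cut_terms_list_in_sterms:
      "set ts \<subseteq> sterms S ar \<Longrightarrow> set (cut_terms_list k ts) \<subseteq> sterms S ar"
proof (induction k t and k ts rule: cut_terms_cut_terms_list.induct)
  case (3 k s ts)
  then show ?case by simp
qed auto

text \<open>The first \<open>k\<close> nodes in preorder contain their parents, and leaves hold the
  places of removed children, so numbers, parents and positions survive.\<close>

lemma
  fixes t :: "'a tm" and ts :: "'a tm list"
  shows edges_from_prune: "edges_from n p l (prune k t) = take k (edges_from n p l t)"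
    and child_edges_from_prune_list:
      "child_edges_from n p l (prune_list k ts) = take k (child_edges_from n p l ts)"
proof (induction k t and k ts arbitrary: n p l and n p l rule: prune_prune_list.induct)
  case (5 k t ts)
  show ?case
  \<comment> \<open>After pruning, the rest is numbered from \<open>n + min k (deg t)\<close>. This
    differs from \<open>n + deg t\<close> only if \<open>k < deg t\<close>, and then no node of the
    rest survives.\<close>
  proof (cases "k < deg t")
    case True
    then show ?thesis using "5.IH" by simp
  next
    case False
    then have "min k (deg t) = deg t" by simp
    then show ?thesis using "5.IH" by simp
  qed
qed auto

text \<open>Edges to parents outside the word become \<open>(0, 0)\<close>, which is below every edge with a genuine
  parent.\<close>

definition norm_edge :: "nat \<Rightarrow> nat \<times> nat \<Rightarrow> nat \<times> nat" where
  "norm_edge n e = (if fst e < n then (0, 0) else e)"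

definition word_edges :: "nat \<Rightarrow> 'a tm list \<Rightarrow> (nat \<times> nat) list" where
  "word_edges n us = map (norm_edge n) (child_edges_from n 0 1 us)"

text \<open>Forgetting root positions makes the relation blind to leaves in the words, which suits
  the two parts of a cut; \<open>word_le_iff_edges_le\<close> shows that nothing is lost for words
  without leaves.\<close>

definition word_le :: "'a tm list \<Rightarrow> 'a tm list \<Rightarrow> bool" where
  "word_le us vs \<longleftrightarrow>
     dcs us = dcs vs \<and> list_all2 edge_le (word_edges 1 us) (word_edges 1 vs)"

lemma norm_edge_cong: "m \<le> n \<Longrightarrow> fst e < m \<or> n \<le> fst e \<Longrightarrow> norm_edge m e = norm_edge n e"
  by (auto simp: norm_edge_def)

lemma norm_edge_norm_edge: "1 \<le> m \<Longrightarrow> m \<le> n \<Longrightarrow> norm_edge n (norm_edge m e) = norm_edge n e"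
  by (auto simp: norm_edge_def)

text \<open>\<open>p\<close> and \<open>l\<close> enter the root edges only, and these are erased
  because \<open>p < n\<close>.\<close>

lemma norm_edges_eq_word_edges:
  assumes "p < n"
  shows "map (norm_edge n) (child_edges_from n p l us) = word_edges n us"
proof -
  have *: "map (norm_edge N) (child_edges_from n p l us) =
    map (norm_edge N) (child_edges_from n q m us)" if "p < N" "q < N" for n N p q l m
    using that
  proof (induction us arbitrary: n l m)
    case (Cons t us)
    from Cons.IH[OF Cons.prems] show ?case
      by (cases t) (auto simp: norm_edge_def Cons.prems)
  qed simp
  from assms show ?thesis unfolding word_edges_def by (intro *) auto
qed

lemma length_word_edges [simp]: "length (word_edges n us) = degs us"
  by (simp add: word_edges_def)

text \<open>Edges of \<open>vs\<close> have parent 0 or a parent among the nodes of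
  \<open>vs\<close>, so the thresholds \<open>n\<close> and \<open>n + degs us\<close> erase the
  same ones.\<close>

lemma word_edges_append:
  assumes "1 \<le> n"
  shows "word_edges n (us @ vs) = word_edges n us @ word_edges (n + degs us) vs"
proof -
  have "map (norm_edge n) (child_edges_from (n + degs us) 0 (1 + length us) vs) =
    map (norm_edge (n + degs us)) (child_edges_from (n + degs us) 0 (1 + length us) vs)"
  proof (rule map_cong[OF refl])
    fix e assume "e \<in> set (child_edges_from (n + degs us) 0 (1 + length us) vs)"
    with child_edges_from_bounds[OF this] assms
    show "norm_edge n e = norm_edge (n + degs us) e" by (intro norm_edge_cong) auto
  qed
  also have "\<dots> = word_edges (n + degs us) vs"
    using assms by (intro norm_edges_eq_word_edges) auto
  finally show ?thesis by (simp add: word_edges_def child_edges_from_append)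
qed

lemma word_edges_nonleaf [simp]:
  assumes "1 \<le> n"
  shows "word_edges n (nonleaf us) = word_edges n us"
  using assms
proof (induction us arbitrary: n)
  case (Cons t us)
  have "word_edges n (t # us) = word_edges n [t] @ word_edges (n + deg t) us"
    using word_edges_append[of n "[t]" us] Cons.prems by simp
  moreover have "word_edges n (t # nonleaf us) = word_edges n [t] @ word_edges (n + deg t) (nonleaf us)"
    using word_edges_append[of n "[t]" "nonleaf us"] Cons.prems by simp
  moreover have "word_edges n [Leaf] = []" by (simp add: word_edges_def)
  ultimately show ?case using Cons by auto
qed (simp add: word_edges_def)

lemma word_le_nonleaf [simp]:
  "word_le us (nonleaf vs) \<longleftrightarrow> word_le us vs" "word_le (nonleaf us) vs \<longleftrightarrow> word_le us vs"
  by (simp_all add: word_le_def)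

text \<open>Erased edges stay \<open>(0, 0)\<close> while the others move by \<open>d\<close>;
  genuine parents are at least 1 already, so mixed comparisons do not change.\<close>

lemma word_edges_shift:
  fixes us vs :: "'a tm list"
  assumes "1 \<le> n"
  shows "list_all2 edge_le (word_edges (n + d) us) (word_edges (n + d) vs) \<longleftrightarrow>
    list_all2 edge_le (word_edges n us) (word_edges n vs)"
proof -
  have "word_edges (n + d) us = map (\<lambda>e. norm_edge (n + d) (shift d e)) (child_edges_from n 0 1 us)"
    for us :: "'a tm list"
    using norm_edges_eq_word_edges[of d "n + d" 1 us] child_edges_from_shift[of n d 0 1 us] assms
    by (simp add: comp_def)
  moreover have "edge_le (norm_edge (n + d) (shift d e)) (norm_edge (n + d) (shift d e')) \<longleftrightarrow>
    edge_le (norm_edge n e) (norm_edge n e')" for e e'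
    using assms by (auto simp: norm_edge_def shift_def edge_le_def)
  ultimately show ?thesis
    unfolding word_edges_def[of n] by (simp add: list_all2_map1 list_all2_map2)
qed

lemma word_edges_prune_list: "word_edges n (prune_list k ts) = take k (word_edges n ts)"
  by (simp add: word_edges_def child_edges_from_prune_list take_map)

text \<open>Past the cut, an edge with parent before it leads to the root of a cut subterm; the
  threshold \<open>n + k\<close> erases exactly these.\<close>

lemma
  fixes t :: "'a tm" and ts :: "'a tm list"
  shows norm_edges_cut_terms: "p < n \<Longrightarrow>
      word_edges (n + k) (cut_terms k t) = map (norm_edge (n + k)) (drop k (edges_from n p l t))"
    and norm_edges_cut_terms_list: "p < n \<Longrightarrow>
      word_edges (n + k) (cut_terms_list k ts) =
      map (norm_edge (n + k)) (drop k (child_edges_from n p l ts))"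
proof (induction k t and k ts arbitrary: n p l and n p l rule: cut_terms_cut_terms_list.induct)
  case (1 t)
  then show ?case using norm_edges_eq_word_edges[of p n l "[t]"] by simp
next
  case (3 k s ts)
  then show ?case using "3.IH"[of n "n + 1" 1] by simp
next
  case (5 k t ts)
  \<comment> \<open>\<open>N\<close> is \<open>n\<close> plus the maximum of \<open>k\<close> and
    \<open>deg t\<close>. For \<open>k < deg t\<close> it exceeds \<open>n + k\<close>, but parents
    in \<open>ts\<close> are \<open>p\<close> or at least \<open>n + deg t\<close>, so both
    thresholds agree there.\<close>
  define N where "N = n + deg t + (k - deg t)"
  have N: "n + k + (deg t - k) = N" "n + k \<le> N" by (auto simp: N_def)
  have "word_edges (n + k) (cut_terms_list k (t # ts)) =
    word_edges (n + k) (cut_terms k t) @ word_edges N (cut_terms_list (k - deg t) ts)"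
    using word_edges_append[of "n + k" "cut_terms k t" "cut_terms_list (k - deg t) ts"] "5.prems" N
    by simp
  also have "word_edges N (cut_terms_list (k - deg t) ts) =
    map (norm_edge N) (drop (k - deg t) (child_edges_from (n + deg t) p (l + 1) ts))"
    unfolding N_def using "5.IH"(2)[of p "n + deg t" "l + 1"] "5.prems" by simp
  also have "\<dots> =
    map (norm_edge (n + k)) (drop (k - deg t) (child_edges_from (n + deg t) p (l + 1) ts))"
  proof (rule map_cong[OF refl])
    fix e assume "e \<in> set (drop (k - deg t) (child_edges_from (n + deg t) p (l + 1) ts))"
    then have "e \<in> set (child_edges_from (n + deg t) p (l + 1) ts)" by (rule in_set_dropD)
    with child_edges_from_bounds[OF this] "5.prems" N
    show "norm_edge N e = norm_edge (n + k) e"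
      by (intro norm_edge_cong[symmetric]) (auto simp: N_def)
  qed
  also have "word_edges (n + k) (cut_terms k t) =
      map (norm_edge (n + k)) (drop k (edges_from n p l t))"
    using "5.IH"(1) "5.prems" by simp
  finally show ?case by (simp add: drop_append)
qed (auto simp: word_edges_def)

lemma word_edges_cut_terms_list:
  assumes "1 \<le> n"
  shows "word_edges (n + k) (cut_terms_list k ts) = map (norm_edge (n + k)) (drop k (word_edges n ts))"
  using norm_edges_cut_terms_list[of 0 n k ts 1] assms
  by (simp add: word_edges_def drop_map comp_def norm_edge_norm_edge)

lemma edges_le_norm_edge:
  assumes "1 \<le> n" "list_all2 edge_le xs ys"
  shows "list_all2 edge_le (map (norm_edge n) xs) (map (norm_edge n) ys)"
  using assms(2) unfolding list_all2_map1 list_all2_map2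
  by (rule list_all2_mono) (use assms(1) in \<open>auto simp: edge_le_def norm_edge_def\<close>)

text \<open>Replacing the edges of \<open>vs\<close> that cross the cut by root edges loses nothing: each edge of \<open>us2\<close>
  is either a root edge, below everything, or has its parent in \<open>us2\<close>.\<close>

lemma append_word_le_iff:
  assumes "dcs vs = dcs us1 @ dcs us2"
  shows "word_le (us1 @ us2) vs \<longleftrightarrow>
    word_le us1 (prune_list (degs us1) vs) \<and> word_le us2 (cut_terms_list (degs us1) vs)"
proof -
  define k where "k = degs us1"
  define X where "X = word_edges 1 vs"
  have "list_all2 edge_le (word_edges 1 (us1 @ us2)) X \<longleftrightarrow>
    list_all2 edge_le (word_edges 1 us1) (take k X) \<and>
    list_all2 edge_le (word_edges (1 + k) us2) (drop k X)"
    using assms list_all2_append[of "word_edges 1 us1" "take k X" edge_le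
        "word_edges (1 + k) us2" "drop k X"]
    by (simp add: word_edges_append X_def k_def)
  also have "list_all2 edge_le (word_edges (1 + k) us2) (drop k X) \<longleftrightarrow>
    list_all2 edge_le (word_edges (1 + k) us2) (map (norm_edge (1 + k)) (drop k X))"
  proof -
    have "edge_le (norm_edge (1 + k) e) (norm_edge 1 e') \<longleftrightarrow>
      edge_le (norm_edge (1 + k) e) (norm_edge (1 + k) (norm_edge 1 e'))" for e e'
      by (auto simp: edge_le_def norm_edge_def)
    then show ?thesis
      by (simp add: X_def word_edges_def drop_map list_all2_map1 list_all2_map2)
  qed
  also have "map (norm_edge (1 + k)) (drop k X) = word_edges (1 + k) (cut_terms_list k vs)"
    by (simp add: X_def word_edges_cut_terms_list[of 1, simplified])
  also have "list_all2 edge_le (word_edges (1 + k) us2) \<dots> \<longleftrightarrow>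
    list_all2 edge_le (word_edges 1 us2) (word_edges 1 (cut_terms_list k vs))"
    by (rule word_edges_shift) simp
  also have "take k X = word_edges 1 (prune_list k vs)"
    by (simp add: X_def word_edges_prune_list)
  finally show ?thesis using assms by (auto simp: word_le_def X_def k_def)
qed

text \<open>Without leaves the roots occupy consecutive positions from \<open>l\<close> on, and each
  contributes one edge with parent \<open>p\<close>.\<close>

lemma root_edge_position:
  assumes "Leaf \<notin> set us" "p < n" "i < degs us" "fst (child_edges_from n p l us ! i) = p"
  shows "snd (child_edges_from n p l us ! i) =
    l + length (filter (\<lambda>e. fst e = p) (take i (child_edges_from n p l us)))"
  using assms
proof (induction us arbitrary: n l i)
  case (Cons t us)
  from Cons.prems obtain s ts where t: "t = Node s ts" by (cases t) auto
  define A where "A = child_edges_from (n + 1) n 1 ts"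
  define B where "B = child_edges_from (n + deg t) p (l + 1) us"
  have E: "child_edges_from n p l (t # us) = (p, l) # A @ B"
    by (simp add: t A_def B_def)
  have A: "fst e \<noteq> p" if "e \<in> set A" for e
    using child_edges_from_bounds[of e "n + 1" n 1 ts] that Cons.prems(2) by (auto simp: A_def)
  have lA: "length A = degs ts" "deg t = Suc (length A)" by (simp_all add: A_def t)
  consider "i = 0" | "0 < i" "i - 1 < length A" | "deg t \<le> i" using lA(2) by linarith
  then show ?case
  proof cases
    case 1
    then show ?thesis unfolding E by simp
  next
    case 2
    then have "fst (A ! (i - 1)) = p"
      using Cons.prems(4) unfolding E by (simp add: nth_append nth_Cons')
    with A 2 show ?thesis by auto
  next
    case 3
    define j where "j = i - deg t"
    have i: "i = Suc (length A + j)" using 3 lA(2) by (simp add: j_def)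
    have "filter (\<lambda>e. fst e = p) A = []" using A by (auto simp: filter_empty_conv)
    moreover have "fst (B ! j) = p"
      using Cons.prems(4) unfolding E i by (simp add: nth_append)
    then have "snd (B ! j) = l + 1 + length (filter (\<lambda>e. fst e = p) (take j B))"
      unfolding B_def using Cons.prems(1-3) i lA(2)
      by (intro Cons.IH) auto
    ultimately show ?thesis unfolding E i by (simp add: nth_append)
  qed
qed simp

lemma length_filter_le_of_list_all2:
  "list_all2 (\<lambda>x y. P y \<longrightarrow> P x) xs ys \<Longrightarrow> length (filter P ys) \<le> length (filter P xs)"
  by (induction rule: list_all2_induct) auto

text \<open>The local position of a root is the number of roots up to it, so having fewer roots
  already makes the root edges larger.\<close>

lemma word_le_iff_edges_le:
  assumes "Leaf \<notin> set us" "Leaf \<notin> set vs"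
  shows "word_le us vs \<longleftrightarrow> dcs us = dcs vs \<and>
    list_all2 edge_le (child_edges_from 1 0 1 us) (child_edges_from 1 0 1 vs)"
proof (cases "dcs us = dcs vs")
  case True
  define A where "A = child_edges_from 1 0 1 us"
  define B where "B = child_edges_from 1 0 1 vs"
  have len: "length A = degs vs" "length B = degs vs" by (simp_all add: A_def B_def True)
  have "list_all2 edge_le A B" if le: "list_all2 edge_le (map (norm_edge 1) A) (map (norm_edge 1) B)"
  proof -
    have le_nth: "edge_le (norm_edge 1 (A ! i)) (norm_edge 1 (B ! i))" if "i < degs vs" for i
      using le that len by (simp add: list_all2_conv_all_nth)
    \<comment> \<open>\<open>(0, 0)\<close> is above no edge with parent at least 1, so every root
      of \<open>vs\<close> is matched by a root of \<open>us\<close>.\<close>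
    have zero: "fst (A ! i) = 0" if "i < degs vs" "fst (B ! i) = 0" for i
      using le_nth[of i] that by (auto simp: edge_le_def norm_edge_def split: if_splits)
    have "edge_le (A ! i) (B ! i)" if i: "i < degs vs" for i
    proof (cases "fst (B ! i) = 0")
      case False
      with le_nth[OF i] show ?thesis by (auto simp: edge_le_def norm_edge_def split: if_splits)
    next
      case B0: True
      have "list_all2 (\<lambda>x y. fst y = 0 \<longrightarrow> fst x = 0) (take i A) (take i B)"
        using i len zero by (auto simp: list_all2_conv_all_nth)
      note length_filter_le_of_list_all2[OF this]
      moreover have "snd (A ! i) = 1 + length (filter (\<lambda>e. fst e = 0) (take i A))"
        using zero[OF i B0] assms i len unfolding A_def by (intro root_edge_position) auto
      moreover have "snd (B ! i) = 1 + length (filter (\<lambda>e. fst e = 0) (take i B))"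
        using B0 assms i len unfolding B_def by (intro root_edge_position) auto
      ultimately show ?thesis using zero[OF i B0] B0 by (simp add: edge_le_def)
    qed
    with len show ?thesis by (simp add: list_all2_conv_all_nth)
  qed
  with True show ?thesis
    using edges_le_norm_edge[of 1 A B] by (auto simp: word_le_def word_edges_def A_def B_def)
qed (simp add: word_le_def)

section \<open>Grafting on extreme leaves\<close>

text \<open>Runs parallel to \<open>cut_terms\<close> and lists the slots below the cut: the parent
  edges available to the cut subterms, leaves included.\<close>

fun cut_edges :: "nat \<Rightarrow> nat \<Rightarrow> nat \<Rightarrow> nat \<Rightarrow> 'a tm \<Rightarrow> (nat \<times> nat) list"
  and cut_edges_list :: "nat \<Rightarrow> nat \<Rightarrow> nat \<Rightarrow> nat \<Rightarrow> 'a tm list \<Rightarrow> (nat \<times> nat) list" where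
  "cut_edges 0 n p l t = [(p, l)]"
| "cut_edges (Suc k) n p l Leaf = []"
| "cut_edges (Suc k) n p l (Node s ts) = cut_edges_list k (n + 1) n 1 ts"
| "cut_edges_list k n p l [] = []"
| "cut_edges_list k n p l (t # ts) =
     cut_edges k n p l t @ cut_edges_list (k - deg t) (n + deg t) p (l + 1) ts"

lemma cut_edges_list_0: "cut_edges_list 0 n p l ts = map (Pair p) [l..<l + length ts]"
proof (induction ts arbitrary: n l)
  case (Cons t ts)
  have "[l..<l + length (t # ts)] = l # [l + 1..<l + 1 + length ts]"
    by (simp add: upt_conv_Cons del: upt_Suc)
  with Cons show ?case by simp
qed simp

lemma
  fixes t :: "'a tm" and ts :: "'a tm list"
  shows length_cut_edges [simp]: "length (cut_edges k n p l t) = length (cut_terms k t)"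
    and length_cut_edges_list [simp]:
      "length (cut_edges_list k n p l ts) = length (cut_terms_list k ts)"
  by (induction k n p l t and k n p l ts rule: cut_edges_cut_edges_list.induct) auto

lemma
  fixes t :: "'a tm" and ts :: "'a tm list"
  shows cut_edges_bounds: "e \<in> set (cut_edges k n p l t) \<Longrightarrow> e = (p, l) \<or> n \<le> fst e"
    and cut_edges_list_bounds:
      "e \<in> set (cut_edges_list k n p l ts) \<Longrightarrow> fst e = p \<and> l \<le> snd e \<or> n \<le> fst e"
  by (induction k n p l t and k n p l ts rule: cut_edges_cut_edges_list.induct) fastforce+

text \<open>The inequality must be strict: at \<open>k = deg t\<close> the leaves visited after the
  last node are still slots, namely the extreme leaves.\<close>

lemma
  fixes t :: "'a tm" and ts :: "'a tm list"
  shows cut_edges_eq_Nil: "deg t < k \<Longrightarrow> cut_edges k n p l t = []"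
    and cut_edges_list_eq_Nil: "degs ts < k \<Longrightarrow> cut_edges_list k n p l ts = []"
  by (induction k n p l t and k n p l ts rule: cut_edges_cut_edges_list.induct) auto

text \<open>The slots depend only on the part before the cut: pruning merely puts leaves into
  them.\<close>

lemma
  fixes t :: "'a tm" and ts :: "'a tm list"
  shows cut_edges_prune: "cut_edges k n p l (prune k t) = cut_edges k n p l t"
    and cut_edges_list_prune_list:
      "cut_edges_list k n p l (prune_list k ts) = cut_edges_list k n p l ts"
proof (induction k n p l t and k n p l ts rule: cut_edges_cut_edges_list.induct)
  case (5 k n p l t ts)
  show ?case
  proof (cases "k < deg t")
    case True
    then show ?thesis using "5.IH"(1) by (simp add: cut_edges_list_0)
  next
    case False
    then have "min k (deg t) = deg t" by simp
    then show ?thesis using "5.IH" by simp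
  qed
qed auto

text \<open>After the cut the traversal only climbs back from the last kept node: slots at later
  parents come first, those of one parent by increasing position. Either way the edges become
  smaller.\<close>

lemma
  fixes t :: "'a tm" and ts :: "'a tm list"
  shows sorted_cut_edges:
      "p < n \<Longrightarrow> sorted_wrt (\<lambda>e e'. edge_le e' e) (cut_edges k n p l t)"
    and sorted_cut_edges_list:
      "p < n \<Longrightarrow> sorted_wrt (\<lambda>e e'. edge_le e' e) (cut_edges_list k n p l ts)"
proof (induction k n p l t and k n p l ts rule: cut_edges_cut_edges_list.induct)
  case (5 k n p l t ts)
  show ?case
  proof (cases "deg t < k")
    case True
    then show ?thesis using 5 by (simp add: cut_edges_eq_Nil)
  next
    \<comment> \<open>Now \<open>k - deg t\<close> is 0, so each term of \<open>ts\<close> is a slot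
      at \<open>p\<close>, below the slots of \<open>t\<close>.\<close>
    case False
    have "edge_le e' e" if "e \<in> set (cut_edges k n p l t)"
      "e' \<in> set (cut_edges_list 0 (n + deg t) p (l + 1) ts)" for e e'
      using cut_edges_bounds[OF that(1)] that(2) "5.prems"
      by (auto simp: cut_edges_list_0 edge_le_def)
    with False 5 show ?thesis by (auto simp: sorted_wrt_append)
  qed
qed auto

text \<open>A cut subterm that is not a leaf contributes exactly one edge with parent before the
  cut, namely its slot; a leaf contributes none.\<close>

lemma
  fixes t :: "'a tm" and ts :: "'a tm list"
  shows root_edges_cut_terms: "p < n \<Longrightarrow>
      filter (\<lambda>e. fst e < n + k) (drop k (edges_from n p l t)) =
      map snd (filter (\<lambda>(v, e). v \<noteq> Leaf) (zip (cut_terms k t) (cut_edges k n p l t)))"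
    and root_edges_cut_terms_list: "p < n \<Longrightarrow>
      filter (\<lambda>e. fst e < n + k) (drop k (child_edges_from n p l ts)) =
      map snd (filter (\<lambda>(v, e). v \<noteq> Leaf)
        (zip (cut_terms_list k ts) (cut_edges_list k n p l ts)))"
proof (induction k n p l t and k n p l ts rule: cut_edges_cut_edges_list.induct)
  case (1 n p l t)
  show ?case
  proof (cases t)
    case (Node s ts)
    have "\<not> fst e < n" if "e \<in> set (child_edges_from (Suc n) n (Suc 0) ts)" for e
      using child_edges_from_bounds[OF that] by auto
    with Node 1 show ?thesis by (auto simp: filter_empty_conv)
  qed simp
next
  case (5 k n p l t ts)
  define N where "N = n + deg t + (k - deg t)"
  define E where "E = drop (k - deg t) (child_edges_from (n + deg t) p (l + 1) ts)"
  have "filter (\<lambda>e. fst e < n + k) E = filter (\<lambda>e. fst e < N) E"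
  proof (rule filter_cong[OF refl])
    fix e assume "e \<in> set E"
    then have "e \<in> set (child_edges_from (n + deg t) p (l + 1) ts)"
      unfolding E_def by (rule in_set_dropD)
    from child_edges_from_bounds[OF this] "5.prems"
    show "fst e < n + k \<longleftrightarrow> fst e < N" by (auto simp: N_def)
  qed
  also have "\<dots> = map snd (filter (\<lambda>(v, e). v \<noteq> Leaf) (zip (cut_terms_list (k - deg t) ts)
      (cut_edges_list (k - deg t) (n + deg t) p (l + 1) ts)))"
    unfolding N_def E_def using "5.prems" by (intro "5.IH"(2)) simp
  finally show ?case using "5.IH"(1)[OF "5.prems"]
    by (simp add: drop_append zip_append E_def)
qed auto

text \<open>The \<open>i\<close>-th entry of a subsequence stands at the \<open>i\<close>-th place
  of \<open>xs\<close> or later, and entries only decrease.\<close>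

lemma subseq_sorted_le_take:
  assumes "sorted_wrt (\<lambda>e e'. edge_le e' e) xs" "subseq ys xs"
  shows "list_all2 edge_le ys (take (length ys) xs)"
  using assms
proof (induction xs arbitrary: ys)
  case (Cons x xs)
  show ?case
  proof (cases ys)
    case (Cons y ys')
    have "subseq ys' xs"
      using Cons.prems(2) unfolding \<open>ys = y # ys'\<close>
      by (auto simp: subseq_Cons2_iff split: if_splits dest: subseq_Cons')
    moreover have "y = x \<or> y \<in> set xs"
      using list_emb_set[OF Cons.prems(2), of y] Cons by auto
    ultimately show ?thesis using Cons.prems(1) Cons.IH[of ys'] Cons by auto
  qed simp
qed simp

text \<open>Equal normalised lists have erased edges at the same places and the same edges
  elsewhere; \<open>1 \<le> n\<close> keeps \<open>(0, 0)\<close> distinct from every kept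
  edge.\<close>

lemma edges_le_of_root_edges_le:
  assumes "1 \<le> n" "map (norm_edge n) xs = map (norm_edge n) ys"
    and "list_all2 edge_le (filter (\<lambda>e. fst e < n) xs) (filter (\<lambda>e. fst e < n) ys)"
  shows "list_all2 edge_le xs ys"
  using assms(2,3)
proof (induction xs arbitrary: ys)
  case (Cons x xs)
  then obtain y ys' where ys: "ys = y # ys'" by (cases ys) auto
  with Cons.prems(1) assms(1) have "fst x < n \<and> fst y < n \<or> \<not> fst x < n \<and> x = y"
    by (auto simp: norm_edge_def split: if_splits)
  with Cons ys show ?case by auto
qed simp

lemma filter_zip_fst:
  assumes "length xs = length ys"
  shows "map fst (filter (\<lambda>(x, y). P x) (zip xs ys)) = filter P xs"
  using assms by (induction xs ys rule: list_induct2) auto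

lemma filter_zip_prefix:
  assumes "Leaf \<notin> set vs" "length ys = length vs + r"
  shows "map snd (filter (\<lambda>(v, e). v \<noteq> Leaf) (zip (vs @ replicate r Leaf) ys)) =
    take (length vs) ys"
  using assms
proof (induction vs arbitrary: ys)
  case Nil
  have "filter (\<lambda>(v, e). v \<noteq> Leaf) (zip (replicate r Leaf) ys) = []"
    by (auto simp: filter_empty_conv dest: set_zip_leftD)
  then show ?case by simp
next
  case (Cons v vs)
  then show ?case by (cases ys) auto
qed

text \<open>The chosen cut edges of \<open>cs\<close> form a subsequence of the decreasing list of all cut edges,
  whereas \<open>gs\<close> uses an initial segment of it.\<close>

lemma greedy_edges_le:
  assumes "p < n" "prune_list k cs = prune_list k gs"
    and "cut_terms_list k gs = vs @ replicate r Leaf" "Leaf \<notin> set vs"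
    and "nonleaf (cut_terms_list k cs) = vs"
  shows "list_all2 edge_le (child_edges_from n p l cs) (child_edges_from n p l gs)"
proof -
  define C where "C = child_edges_from n p l cs"
  define G where "G = child_edges_from n p l gs"
  define X where "X = cut_edges_list k n p l cs"
  \<comment> \<open>Slots are determined by the initial part, which \<open>cs\<close> and
    \<open>gs\<close> share.\<close>
  have X': "X = cut_edges_list k n p l gs"
    unfolding X_def using assms(2) by (metis cut_edges_list_prune_list)
  have len: "length X = length vs + r"
    unfolding X' using assms(3) by simp
  have "take k C = take k G"
    unfolding C_def G_def using assms(2) by (metis child_edges_from_prune_list)
  moreover have "list_all2 edge_le (drop k C) (drop k G)"
  proof (rule edges_le_of_root_edges_le)
    show "1 \<le> n + k" using assms(1) by simp
    have "word_edges (n + k) (cut_terms_list k cs) = word_edges (n + k) (cut_terms_list k gs)"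
      using word_edges_nonleaf[of "n + k" "cut_terms_list k cs"]
        word_edges_nonleaf[of "n + k" "cut_terms_list k gs"] assms
      by (simp add: filter_id_conv)
    then show "map (norm_edge (n + k)) (drop k C) = map (norm_edge (n + k)) (drop k G)"
      unfolding C_def G_def norm_edges_cut_terms_list[OF assms(1), symmetric] .
    define R where "R = filter (\<lambda>(v, e). v \<noteq> Leaf) (zip (cut_terms_list k cs) X)"
    have "length R = length vs"
      using arg_cong[OF filter_zip_fst[of "cut_terms_list k cs" X "\<lambda>v. v \<noteq> Leaf"], of length]
        assms(5) by (simp add: R_def X_def)
    moreover have "subseq (map snd R) X"
      using subseq_map[OF subseq_filter_left, of snd "\<lambda>(v, e). v \<noteq> Leaf"
          "zip (cut_terms_list k cs) X"]
      by (simp add: R_def X_def)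
    ultimately have "list_all2 edge_le (map snd R) (take (length vs) X)"
      using subseq_sorted_le_take[OF sorted_cut_edges_list[OF assms(1)], of "map snd R" k l cs]
      by (simp add: X_def)
    moreover have "filter (\<lambda>e. fst e < n + k) (drop k C) = map snd R"
      using root_edges_cut_terms_list[OF assms(1)] by (simp add: C_def R_def X_def)
    moreover have "filter (\<lambda>e. fst e < n + k) (drop k G) = take (length vs) X"
      using root_edges_cut_terms_list[OF assms(1), of k l gs] filter_zip_prefix[OF assms(4) len]
      by (simp add: G_def assms(3) flip: X')
    ultimately show "list_all2 edge_le (filter (\<lambda>e. fst e < n + k) (drop k C))
        (filter (\<lambda>e. fst e < n + k) (drop k G))" by simp
  qed
  ultimately have "list_all2 edge_le (take k C @ drop k C) (take k G @ drop k G)"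
    by (intro list_all2_appendI) (auto intro: list_all2_refl)
  then show ?thesis by (simp add: C_def G_def)
qed

section \<open>Extreme leaves as positions of the preorder word\<close>

definition count_nodes :: "'a option list \<Rightarrow> nat" where
  "count_nodes w = length (filter (\<lambda>x. x \<noteq> None) w)"

lemma count_nodes_simps [simp]:
  "count_nodes [] = 0" "count_nodes (None # w) = count_nodes w"
  "count_nodes (Some s # w) = Suc (count_nodes w)"
  "count_nodes (w @ w') = count_nodes w + count_nodes w'"
  by (simp_all add: count_nodes_def)

lemma count_nodes_replicate_None [simp]: "count_nodes (replicate m None) = 0"
  by (simp add: count_nodes_def)

lemma count_nodes_eq_0_iff: "count_nodes w = 0 \<longleftrightarrow> (\<forall>x\<in>set w. x = None)"
  by (simp add: count_nodes_def filter_empty_conv)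

lemma count_nodes_preorder [simp]: "count_nodes (preorder t) = deg t"
proof (induction t)
  case (Node s ts)
  then have "count_nodes (List.concat (map preorder ts)) = degs ts" by (induction ts) auto
  then show ?case by simp
qed simp

lemma count_nodes_preorders [simp]: "count_nodes (List.concat (map preorder ts)) = degs ts"
  by (induction ts) auto

text \<open>The hypothesis says that the positions from \<open>b\<close> on are exactly those preceded by at
  least \<open>k\<close> internal nodes.\<close>

lemma
  fixes t :: "'a tm" and ts :: "'a tm list"
  shows prune_cut_subst_leaves:
    "\<forall>q<b. f q = Leaf \<Longrightarrow>
     \<forall>i<length (preorder t). b \<le> p + i \<longleftrightarrow> k \<le> count_nodes (take i (preorder t)) \<Longrightarrow> deg t \<le> k \<Longrightarrow>
     prune k (subst_leaves f p t) = t \<and>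
     cut_terms k (subst_leaves f p t) = map f (filter (\<lambda>q. b \<le> q) [p..<p + length (preorder t)])"
  and prune_cut_subst_leaves_list:
    "\<forall>q<b. f q = Leaf \<Longrightarrow>
     \<forall>i<length (List.concat (map preorder ts)).
       b \<le> p + i \<longleftrightarrow> k \<le> count_nodes (take i (List.concat (map preorder ts))) \<Longrightarrow> degs ts \<le> k \<Longrightarrow>
     prune_list k (subst_leaves_list f p ts) = ts \<and>
     cut_terms_list k (subst_leaves_list f p ts) =
       map f (filter (\<lambda>q. b \<le> q) [p..<p + length (List.concat (map preorder ts))])"
proof (induction f p t and f p ts arbitrary: k and k
    rule: subst_leaves_subst_leaves_list.induct)
  case (1 f p)
  then show ?case by (cases k) auto
next
  case (2 f p s ts)
  from "2.prems"(3) obtain k' where k: "k = Suc k'" "degs ts \<le> k'" by (cases k) auto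
  define w where "w = List.concat (map preorder ts)"
  have pos: "b \<le> p + i \<longleftrightarrow> k \<le> count_nodes (take i (Some s # w))" if "i < Suc (length w)" for i
    using "2.prems"(2) that by (simp add: w_def)
  have "\<forall>i<length w. b \<le> p + 1 + i \<longleftrightarrow> k' \<le> count_nodes (take i w)"
  proof (intro allI impI)
    fix i assume "i < length w"
    with pos[of "Suc i"] show "b \<le> p + 1 + i \<longleftrightarrow> k' \<le> count_nodes (take i w)" by (simp add: k)
  qed
  note IH = "2.IH"[OF "2.prems"(1) this[unfolded w_def] k(2)]
  \<comment> \<open>No internal node precedes the root while \<open>k\<close> is positive, so
    position \<open>p\<close> is below \<open>b\<close> and drops out.\<close>
  have "\<not> b \<le> p" using pos[of 0] k by simp
  then show ?case using IH by (simp add: k upt_conv_Cons del: upt_Suc)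
next
  case (4 f p t ts)
  define w where "w = List.concat (map preorder ts)"
  define m where "m = length (preorder t)"
  have pos: "b \<le> p + i \<longleftrightarrow> k \<le> count_nodes (take i (preorder t @ w))" if "i < m + length w" for i
    using "4.prems"(2) that by (simp add: w_def m_def)
  have "\<forall>i<length (preorder t). b \<le> p + i \<longleftrightarrow> k \<le> count_nodes (take i (preorder t))"
  proof (intro allI impI)
    fix i assume "i < length (preorder t)"
    with pos[of i] show "b \<le> p + i \<longleftrightarrow> k \<le> count_nodes (take i (preorder t))"
      by (simp add: m_def)
  qed
  note IH1 = "4.IH"(1)[OF "4.prems"(1) this]
  have "\<forall>i<length w. b \<le> p + m + i \<longleftrightarrow> k - deg t \<le> count_nodes (take i w)"
  proof (intro allI impI)
    fix i assume "i < length w"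
    with pos[of "m + i"] show "b \<le> p + m + i \<longleftrightarrow> k - deg t \<le> count_nodes (take i w)"
      by (auto simp: m_def add.assoc)
  qed
  note IH2 = "4.IH"(2)[OF "4.prems"(1) this[unfolded m_def w_def]]
  have k: "deg t \<le> k" "degs ts \<le> k - deg t" using "4.prems"(3) by auto
  \<comment> \<open>Grafting can change the degree of \<open>t\<close> only when
    \<open>k = deg t\<close>; with truncated subtraction the cut passed on to \<open>ts\<close> is
    \<open>k - deg t\<close> in either case.\<close>
  from IH1[OF k(1)] have "min k (deg (subst_leaves f p t)) = deg t"
    by (metis deg_prune)
  then have "k - deg (subst_leaves f p t) = k - deg t" by linarith
  then show ?case using IH1[OF k(1)] IH2[OF k(2)]
    by (simp add: upt_add_eq_append[of p "p + length (preorder t)"] add.assoc[symmetric])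
qed auto

lemma
  fixes t :: "'a tm" and ts :: "'a tm list"
  shows subst_leaves_in_sterms:
      "\<forall>q. f q \<in> sterms S ar \<Longrightarrow> t \<in> sterms S ar \<Longrightarrow> subst_leaves f p t \<in> sterms S ar"
    and subst_leaves_list_in_sterms:
      "\<forall>q. f q \<in> sterms S ar \<Longrightarrow> set ts \<subseteq> sterms S ar \<Longrightarrow>
       set (subst_leaves_list f p ts) \<subseteq> sterms S ar \<and> length (subst_leaves_list f p ts) = length ts"
  by (induction f p t and f p ts rule: subst_leaves_subst_leaves_list.induct) auto

text \<open>Once all \<open>deg t\<close> nodes have been passed, only leaves can follow, so
  \<open>p\<close> itself holds a leaf.\<close>

lemma extreme_leaves_eq:
  "extreme_leaves t = {p. p < length (preorder t) \<and> deg t \<le> count_nodes (take p (preorder t))}"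
proof -
  define w where "w = preorder t"
  have "deg t \<le> count_nodes (take p w) \<longleftrightarrow> (\<forall>q<length w. p \<le> q \<longrightarrow> w ! q = None)" for p
  proof -
    have "deg t = count_nodes (take p w) + count_nodes (drop p w)"
      by (metis append_take_drop_id count_nodes_preorder count_nodes_simps(4) w_def)
    then have "deg t \<le> count_nodes (take p w) \<longleftrightarrow> (\<forall>x\<in>set (drop p w). x = None)"
      by (simp flip: count_nodes_eq_0_iff)
    also have "\<dots> \<longleftrightarrow> (\<forall>q<length w. p \<le> q \<longrightarrow> w ! q = None)"
    proof
      assume *: "\<forall>x\<in>set (drop p w). x = None"
      show "\<forall>q<length w. p \<le> q \<longrightarrow> w ! q = None"
      proof (intro allI impI)
        fix q assume "q < length w" "p \<le> q"
        then have "drop p w ! (q - p) = w ! q" "q - p < length (drop p w)" by auto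
        with * show "w ! q = None" by (metis nth_mem)
      qed
    qed (auto simp: in_set_conv_nth)
    finally show ?thesis .
  qed
  then show ?thesis by (auto simp: extreme_leaves_def simp flip: w_def not_le)
qed

text \<open>The number of nodes before a position grows with the position, so reaching
  \<open>deg t\<close> defines a final segment.\<close>

lemma extreme_leaves_interval:
  obtains b where "b \<le> length (preorder t)" "extreme_leaves t = {b..<length (preorder t)}"
    "\<And>p. b \<le> p \<longleftrightarrow> deg t \<le> count_nodes (take p (preorder t))"
proof -
  define P where "P p \<longleftrightarrow> deg t \<le> count_nodes (take p (preorder t))" for p
  define b where "b = (LEAST p. P p)"
  have P_len: "P (length (preorder t))" by (simp add: P_def)
  have mono: "P q" if "P p" "p \<le> q" for p q
  proof -
    have "take q (preorder t) = take p (preorder t) @ take (q - p) (drop p (preorder t))"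
      using that(2) take_add[of p "q - p" "preorder t"] by simp
    with that(1) show ?thesis by (simp add: P_def)
  qed
  have "P b" unfolding b_def by (rule LeastI[of P, OF P_len])
  then have "b \<le> p \<longleftrightarrow> P p" for p
    using mono[of b p] Least_le[of P p] unfolding b_def by blast
  then have b: "b \<le> p \<longleftrightarrow> deg t \<le> count_nodes (take p (preorder t))" for p
    unfolding P_def .
  show thesis
  proof
    show "b \<le> length (preorder t)" unfolding b_def using P_len by (rule Least_le)
    show "extreme_leaves t = {b..<length (preorder t)}"
      unfolding extreme_leaves_eq b[symmetric] by auto
  qed (rule b)
qed

text \<open>Cutting undoes grafting: all nodes of \<open>t\<close> precede its extreme leaves, so
  after grafting its nodes still come first and the slots below them are the former extreme
  leaves.\<close>

lemma
  assumes "length us = card (extreme_leaves t)"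
  shows prune_graft_extreme: "prune (deg t) (graft_extreme us t) = t"
    and cut_terms_graft_extreme: "cut_terms (deg t) (graft_extreme us t) = us"
proof -
  define N where "N = length (preorder t)"
  obtain b where b: "b \<le> N" "extreme_leaves t = {b..<N}"
    "\<And>p. b \<le> p \<longleftrightarrow> deg t \<le> count_nodes (take p (preorder t))"
    unfolding N_def using extreme_leaves_interval[of t] by blast
  define f where "f = (\<lambda>p. if p \<in> extreme_leaves t
    then us ! card {q \<in> extreme_leaves t. q < p} else Leaf)"
  have len: "length us = N - b" using assms b(2) by simp
  \<comment> \<open>The extreme leaves form an interval starting at \<open>b\<close>, so
    \<open>q\<close> has rank \<open>q - b\<close> among them.\<close>
  have f: "f q = us ! (q - b)" if "b \<le> q" "q < N" for q
  proof -
    have "{q' \<in> extreme_leaves t. q' < q} = {b..<q}" using that b(2) by auto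
    with that b(2) show ?thesis by (simp add: f_def)
  qed
  have "map f (filter (\<lambda>q. b \<le> q) [0..<N]) = us"
  proof -
    have "[0..<N] = [0..<b] @ [b..<N]" using b(1) by (metis le_add_diff_inverse upt_add_eq_append zero_le)
    then have "filter (\<lambda>q. b \<le> q) [0..<N] = [b..<N]" by (simp add: filter_empty_conv filter_id_conv)
    then show ?thesis using len f by (auto intro!: nth_equalityI)
  qed
  moreover have "\<forall>q<b. f q = Leaf" unfolding f_def b(2) by simp
  then have "prune (deg t) (subst_leaves f 0 t) = t \<and> cut_terms (deg t) (subst_leaves f 0 t) =
      map f (filter (\<lambda>q. b \<le> q) [0..<0 + length (preorder t)])"
    by (rule prune_cut_subst_leaves) (simp_all only: b(3) add_0 order_refl simp_thms)
  moreover have "graft_extreme us t = subst_leaves f 0 t"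
    unfolding graft_extreme_def f_def ..
  ultimately show "prune (deg t) (graft_extreme us t) = t"
    "cut_terms (deg t) (graft_extreme us t) = us"
    by (simp_all add: N_def)
qed

lemma graft_extreme_in_sterms:
  assumes "length us = card (extreme_leaves t)" "set us \<subseteq> sterms S ar" "t \<in> sterms S ar"
  shows "graft_extreme us t \<in> sterms S ar"
proof -
  have "us ! card {q \<in> extreme_leaves t. q < p} \<in> sterms S ar" if "p \<in> extreme_leaves t" for p
  proof -
    have "finite (extreme_leaves t)" by (simp add: extreme_leaves_eq)
    with that have "card {q \<in> extreme_leaves t. q < p} < card (extreme_leaves t)"
      by (intro psubset_card_mono) auto
    with assms show ?thesis by (metis nth_mem subsetD)
  qed
  then show ?thesis unfolding graft_extreme_def
    by (intro subst_leaves_in_sterms assms(3)) auto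
qed

text \<open>Leaves appended at the root end the preorder word. The two decorations may differ
  because concatenation with a corolla alters the root.\<close>

lemma card_extreme_leaves_append_Leaf:
  "card (extreme_leaves (Node s' (ts @ replicate m Leaf))) = card (extreme_leaves (Node s ts)) + m"
proof -
  define w where "w = List.concat (map preorder ts)"
  have w': "List.concat (map preorder (ts @ replicate m Leaf)) = w @ replicate m None"
    by (induction m) (auto simp: w_def)
  let ?N = "Suc (length w)"
  have "extreme_leaves (Node s' (ts @ replicate m Leaf)) =
    extreme_leaves (Node s ts) \<union> {?N..<?N + m}"
    unfolding extreme_leaves_eq
    using count_nodes_preorders[of ts] by (auto simp: w' take_Cons' simp flip: w_def)
  moreover have "extreme_leaves (Node s ts) \<inter> {?N..<?N + m} = {}" "finite (extreme_leaves (Node s ts))"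
    by (auto simp: extreme_leaves_eq simp flip: w_def)
  ultimately show ?thesis by (simp add: card_Un_disjoint)
qed

section \<open>Leaning forests as words\<close>

definition leaning_words :: "'s set \<Rightarrow> ('s \<Rightarrow> nat) \<Rightarrow> ('s + nat) tm list set" where
  "leaning_words S ar = {us. set us \<subseteq> sterms (Inl ` S) (arN ar) - {Leaf}}"

text \<open>Balance forces as many root children as there are nodes in \<open>us\<close>. A word
  without leaves has at most that many trees, so the subtraction is exact on
  \<open>leaning_words\<close>.\<close>

definition leaning_forest :: "('s + nat) tm list \<Rightarrow> ('s + nat) tm" where
  "leaning_forest us = Node (Inr (degs us)) (us @ replicate (degs us - length us) Leaf)"

lemma nonleaf_words [simp]: "us \<in> leaning_words S ar \<Longrightarrow> nonleaf us = us"
  by (auto simp: leaning_words_def filter_id_conv)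

lemma Leaf_notin_words: "us \<in> leaning_words S ar \<Longrightarrow> Leaf \<notin> set us"
  by (auto simp: leaning_words_def)

lemma length_words_le: "us \<in> leaning_words S ar \<Longrightarrow> length us \<le> degs us"
  using length_nonleaf_le_degs[of us] by simp

lemma nonleaf_in_leaning_words:
  "set us \<subseteq> sterms (Inl ` S) (arN ar) \<Longrightarrow> nonleaf us \<in> leaning_words S ar"
  by (auto simp: leaning_words_def)

lemma append_in_leaning_words [simp]:
  "us @ vs \<in> leaning_words S ar \<longleftrightarrow> us \<in> leaning_words S ar \<and> vs \<in> leaning_words S ar"
  by (auto simp: leaning_words_def)

lemma leaning_eq_image: "leaning S ar = leaning_forest ` leaning_words S ar"
proof (intro equalityI subsetI)
  fix F assume F: "F \<in> leaning S ar"
  then obtain ts where ts: "F = Node (Inr (length ts)) ts"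
    "set ts \<subseteq> sterms (Inl ` S) (arN ar)" "degs ts = length ts"
    "nonleaf ts @ filter (\<lambda>t. t = Leaf) ts = ts"
    by (auto simp: leaning_def balanced_def forests_def)
  have "filter (\<lambda>t. t = Leaf) ts = replicate (length (filter (\<lambda>t. t = Leaf) ts)) Leaf"
    by (intro replicate_eqI) auto
  moreover have "length (filter (\<lambda>t. t = Leaf) ts) = degs ts - length (nonleaf ts)"
    using arg_cong[OF ts(4), of length] ts(3) by simp
  ultimately have "F = leaning_forest (nonleaf ts)"
    using ts by (simp add: leaning_forest_def)
  with ts(2) show "F \<in> leaning_forest ` leaning_words S ar"
    by (blast intro: nonleaf_in_leaning_words)
next
  fix F assume "F \<in> leaning_forest ` leaning_words S ar"
  then obtain us where us: "us \<in> leaning_words S ar" "F = leaning_forest us" by blast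
  then show "F \<in> leaning S ar"
    using length_words_le[OF us(1)] Leaf_notin_words[OF us(1)]
    by (auto simp: leaning_def balanced_def forests_def leaning_forest_def leaning_words_def
        filter_empty_conv filter_id_conv)
qed

lemma inj_on_leaning_forest: "inj_on leaning_forest (leaning_words S ar)"
proof (rule inj_on_inverseI)
  fix us assume "us \<in> leaning_words S ar"
  then show "nonleaf (children (leaning_forest us)) = us"
    by (simp add: leaning_forest_def)
qed

lemma forest_over_leaning_forest:
  assumes "us \<in> leaning_words S ar" "vs \<in> leaning_words S ar"
  shows "forest_over (leaning_forest us) (leaning_forest vs) = leaning_forest (us @ vs)"
proof -
  have "filter (\<lambda>t. t = Leaf) us = []" "filter (\<lambda>t. t = Leaf) vs = []"
    using assms[THEN Leaf_notin_words] by (auto simp: filter_empty_conv)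
  then show ?thesis using assms assms[THEN length_words_le]
    by (simp add: forest_over_def leaning_forest_def replicate_add[symmetric])
qed

text \<open>The root of a forest is decorated outside the copy of \<open>S\<close>; enlarging the
  carrier to \<open>UNIV\<close> lets the lemmas on terms apply to whole forests.\<close>

lemma sterms_mono: "t \<in> sterms S ar \<Longrightarrow> S \<subseteq> T \<Longrightarrow> t \<in> sterms T ar"
  by (induction rule: sterms.induct) auto

lemma leaning_words_subset_sterms:
  "us \<in> leaning_words S ar \<Longrightarrow> set us \<subseteq> sterms UNIV (arN ar)"
  by (auto simp: leaning_words_def intro: sterms_mono)

lemma leaning_forest_in_sterms:
  "us \<in> leaning_words S ar \<Longrightarrow> leaning_forest us \<in> sterms UNIV (arN ar)"
  using length_words_le leaning_words_subset_sterms[of us S ar]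
  by (fastforce simp: leaning_forest_def arN_def)

lemma forest_le_leaning_forest_iff:
  assumes "us \<in> leaning_words S ar" "vs \<in> leaning_words S ar"
  shows "forest_le ar (leaning_forest us) (leaning_forest vs) \<longleftrightarrow> word_le us vs"
  using tm_le_Node_iff[OF assms[THEN leaning_forest_in_sterms, unfolded leaning_forest_def]]
    assms[THEN Leaf_notin_words]
  by (auto simp: leaning_forest_def word_le_iff_edges_le child_edges_from_append)

lemma leaning_words_inject:
  assumes "us \<in> leaning_words S ar" "vs \<in> leaning_words S ar" "dcs us = dcs vs"
    and "child_edges_from 1 0 1 us = child_edges_from 1 0 1 vs"
  shows "us = vs"
proof -
  \<comment> \<open>Padding gives both words the same length, as
    \<open>child_edges_from_inject\<close> demands, and adds no edges.\<close>
  let ?pad = "\<lambda>us. us @ replicate (degs us - length us) (Leaf :: ('a + nat) tm)"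
  have "?pad us = ?pad vs"
    using assms assms(1,2)[THEN leaning_words_subset_sterms] assms(1,2)[THEN length_words_le]
    by (intro child_edges_from_inject[of _ UNIV "arN ar" _ 1 0 1])
       (auto simp: child_edges_from_append)
  then have "nonleaf (?pad us) = nonleaf (?pad vs)" by (rule arg_cong)
  with assms(1,2) show ?thesis by simp
qed

lemma word_le_refl: "word_le us us"
  by (auto simp: word_le_def intro: list_all2_refl)

lemma word_le_trans: "word_le us vs \<Longrightarrow> word_le vs ws \<Longrightarrow> word_le us ws"
  by (auto simp: word_le_def intro: edges_le_trans)

lemma word_le_antisym:
  assumes "us \<in> leaning_words S ar" "vs \<in> leaning_words S ar" "word_le us vs" "word_le vs us"
  shows "us = vs"
  using assms Leaf_notin_words[OF assms(1)] Leaf_notin_words[OF assms(2)]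
  by (intro leaning_words_inject[OF assms(1,2)])
     (auto simp: word_le_iff_edges_le intro: edges_le_antisym)

section \<open>Words with given decorations and their cuts\<close>

definition words_with_dc :: "'s set \<Rightarrow> ('s \<Rightarrow> nat) \<Rightarrow> ('s + nat) list \<Rightarrow> ('s + nat) tm list set"
  where "words_with_dc S ar d = {us \<in> leaning_words S ar. dcs us = d}"

text \<open>Edges determine a word once its decorations are fixed, and they are bounded: parents by
  the number of nodes, positions by the number of trees or an arity.\<close>

lemma finite_words_with_dc: "finite (words_with_dc S ar d)"
proof (rule inj_on_finite)
  define M where "M = 1 + length d + sum_list (map (arN ar) d)"
  let ?E = "{es. set es \<subseteq> {..length d} \<times> {..M} \<and> length es = length d}"
  show "inj_on (child_edges_from 1 0 1) (words_with_dc S ar d)"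
    by (intro inj_onI leaning_words_inject[of _ S ar]) (auto simp: words_with_dc_def)
  show "finite ?E" by (intro finite_lists_length_eq) auto
  show "child_edges_from 1 0 1 ` words_with_dc S ar d \<subseteq> ?E"
  proof (rule image_subsetI)
    fix us assume us: "us \<in> words_with_dc S ar d"
    from us have W: "us \<in> leaning_words S ar" and d: "dcs us = d" by (auto simp: words_with_dc_def)
    have "(q, m) \<in> {..length d} \<times> {..M}" if e: "(q, m) \<in> set (child_edges_from 1 0 1 us)" for q m
    proof -
      have "q = 0 \<and> m < 1 + length us \<or> q < 1 + length d \<and> 1 \<le> q \<and> m \<le> arN ar (d ! (q - 1))"
        using child_edges_from_arity[OF leaning_words_subset_sterms[OF W] e] d by auto
      moreover have "length us \<le> length d" using length_words_le[OF W] d by simp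
      moreover have "arN ar (d ! (q - 1)) \<le> sum_list (map (arN ar) d)" if "1 \<le> q" "q < 1 + length d"
        using that by (intro member_le_sum_list) auto
      ultimately show ?thesis by (auto simp: M_def)
    qed
    with d show "child_edges_from 1 0 1 us \<in> ?E" by auto
  qed
qed

definition word_init :: "nat \<Rightarrow> 'a tm list \<Rightarrow> 'a tm list" where
  "word_init k ws = nonleaf (prune_list k ws)"

definition word_tail :: "nat \<Rightarrow> 'a tm list \<Rightarrow> 'a tm list" where
  "word_tail k ws = nonleaf (cut_terms_list k ws)"

lemma word_init_tail_in_words:
  assumes "ws \<in> leaning_words S ar"
  shows "word_init k ws \<in> leaning_words S ar" "word_tail k ws \<in> leaning_words S ar"
proof -
  from assms have "set ws \<subseteq> sterms (Inl ` S) (arN ar)" by (auto simp: leaning_words_def)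
  then show "word_init k ws \<in> leaning_words S ar" "word_tail k ws \<in> leaning_words S ar"
    by (simp_all add: word_init_def word_tail_def nonleaf_in_leaning_words prune_list_in_sterms
        cut_terms_list_in_sterms)
qed

lemma word_init_tail_in_words_with_dc:
  assumes "ws \<in> words_with_dc S ar (d1 @ d2)"
  shows "word_init (length d1) ws \<in> words_with_dc S ar d1"
    "word_tail (length d1) ws \<in> words_with_dc S ar d2"
  using assms word_init_tail_in_words[of ws S ar]
  by (auto simp: words_with_dc_def word_init_def word_tail_def)

lemma append_word_le_iff_init_tail:
  assumes "us \<in> words_with_dc S ar d1" "vs \<in> words_with_dc S ar d2"
    and "ws \<in> words_with_dc S ar (d1 @ d2)"
  shows "word_le (us @ vs) ws \<longleftrightarrow>
    word_le us (word_init (length d1) ws) \<and> word_le vs (word_tail (length d1) ws)"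
  using assms append_word_le_iff[of ws us vs]
  by (auto simp: words_with_dc_def word_init_def word_tail_def)

text \<open>In a word without leaves, pruning turns a tree into a leaf only when the cut has been
  passed, and then all later trees as well; so the leaves come last.\<close>

lemma prune_list_eq_word_init:
  "Leaf \<notin> set ws \<Longrightarrow> prune_list k ws =
     word_init k ws @ replicate (length ws - length (word_init k ws)) Leaf"
proof (induction ws arbitrary: k)
  case (Cons t ws)
  show ?case
  proof (cases k)
    case 0
    then show ?thesis by (simp add: word_init_def filter_empty_conv)
  next
    case (Suc k')
    with Cons.prems obtain s ts where "t = Node s ts" by (cases t) auto
    with Suc Cons show ?thesis by (simp add: word_init_def)
  qed
qed (simp add: word_init_def)

text \<open>Describes the under product through its cut: \<open>us\<close> before and
  \<open>vs\<close> after, up to trailing leaves.\<close>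

lemma forest_under_leaning_forest:
  assumes us: "us \<in> leaning_words S ar" and vs: "vs \<in> leaning_words S ar"
  obtains gs r where
    "forest_under (leaning_forest us) (leaning_forest vs) = Node (Inr (degs us + degs vs)) gs"
    "Node (Inr (degs us + degs vs)) gs \<in> sterms UNIV (arN ar)"
    "prune_list (degs us) gs = us @ replicate (degs us + degs vs - length us) Leaf"
    "cut_terms_list (degs us) gs = vs @ replicate r Leaf"
proof -
  define n where "n = degs us + degs vs"
  define r where "r = card (extreme_leaves (leaning_forest us))"
  define T :: "('a + nat) tm" where "T = Node (Inr n) (us @ replicate (n - length us) Leaf)"
  define U where "U = vs @ replicate (degs vs - length vs + r) (Leaf :: ('a + nat) tm)"
  note len = length_words_le[OF us] length_words_le[OF vs]
  have T: "fconcat (leaning_forest us) (corolla (fsize (leaning_forest vs))) = T"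
    using len by (simp add: leaning_forest_def corolla_def fsize_def T_def n_def replicate_add[symmetric])
  have U: "children (fconcat (leaning_forest vs) (corolla r)) = U"
    by (simp add: leaning_forest_def corolla_def U_def replicate_add[symmetric])
  have under: "forest_under (leaning_forest us) (leaning_forest vs) = graft_extreme U T"
    by (simp add: forest_under_def T U Let_def flip: r_def)
  have "card (extreme_leaves T) = r + degs vs"
  proof -
    have "T = Node (Inr n) ((us @ replicate (degs us - length us) Leaf) @ replicate (degs vs) Leaf)"
      using len by (simp add: T_def n_def replicate_add[symmetric])
    then show ?thesis
      by (simp only: card_extreme_leaves_append_Leaf[of _ _ _ "Inr (degs us)"] r_def leaning_forest_def)
  qed
  then have card: "length U = card (extreme_leaves T)" using len by (simp add: U_def)
  obtain gs where gs: "graft_extreme U T = Node (Inr n) gs"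
    by (simp add: graft_extreme_def T_def)
  \<comment> \<open>The root is one node more, so cutting after \<open>deg T\<close> nodes cuts the
    list of root children after \<open>degs us\<close>.\<close>
  have deg: "deg T = Suc (degs us)" by (simp add: T_def)
  show thesis
  proof
    show "forest_under (leaning_forest us) (leaning_forest vs) = Node (Inr (degs us + degs vs)) gs"
      using under gs by (simp add: n_def)
    have "T \<in> sterms UNIV (arN ar)"
      using len leaning_words_subset_sterms[OF us] by (auto simp: T_def n_def arN_def)
    moreover have "set U \<subseteq> sterms UNIV (arN ar)"
      using leaning_words_subset_sterms[OF vs] by (auto simp: U_def)
    ultimately show "Node (Inr (degs us + degs vs)) gs \<in> sterms UNIV (arN ar)"
      using graft_extreme_in_sterms[OF card] gs by (simp only: n_def)
    show "prune_list (degs us) gs = us @ replicate (degs us + degs vs - length us) Leaf"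
      using prune_graft_extreme[OF card] unfolding deg gs by (simp add: T_def n_def)
    show "cut_terms_list (degs us) gs = vs @ replicate (degs vs - length vs + r) Leaf"
      using cut_terms_graft_extreme[OF card] unfolding deg gs by (simp add: U_def)
  qed
qed

text \<open>The lower bound puts \<open>us\<close> and \<open>vs\<close> below the two parts of
  \<open>ws\<close>; cutting is monotone, so the upper bound puts these parts below those of the
  under product, again \<open>us\<close> and \<open>vs\<close>. Conversely, equal parts leave only
  the choice of slots, and the under product chooses greedily.\<close>

lemma interval_iff_init_tail:
  assumes us: "us \<in> leaning_words S ar" and vs: "vs \<in> leaning_words S ar"
    and ws: "ws \<in> leaning_words S ar"
  shows "word_le (us @ vs) ws \<and>
      forest_le ar (leaning_forest ws) (forest_under (leaning_forest us) (leaning_forest vs)) \<longleftrightarrow>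
    dcs ws = dcs us @ dcs vs \<and> word_init (degs us) ws = us \<and> word_tail (degs us) ws = vs"
proof -
  define k where "k = degs us"
  define n where "n = k + degs vs"
  obtain gs r where under: "forest_under (leaning_forest us) (leaning_forest vs) = Node (Inr n) gs"
    and gs: "Node (Inr n) gs \<in> sterms UNIV (arN ar)"
    and prune: "prune_list k gs = us @ replicate (n - length us) Leaf"
    and cut: "cut_terms_list k gs = vs @ replicate r Leaf"
    using forest_under_leaning_forest[OF us vs] unfolding n_def k_def by metis
  have init_gs: "word_init k gs = us" and tail_gs: "word_tail k gs = vs"
    using us vs by (simp_all add: word_init_def word_tail_def prune cut)
  have "dcs gs = take k (dcs gs) @ drop k (dcs gs)" by simp
  also have "\<dots> = dcs us @ dcs vs"
    by (simp only: prune cut flip: dcs_prune_list dcs_cut_terms_list) simp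
  finally have dcs_gs: "dcs gs = dcs us @ dcs vs" .
  have le_iff: "forest_le ar (leaning_forest ws) (Node (Inr n) gs) \<longleftrightarrow>
      dcs ws = dcs gs \<and> list_all2 edge_le (child_edges_from 1 0 1 ws) (child_edges_from 1 0 1 gs)"
    using tm_le_Node_iff[OF _ gs] leaning_forest_in_sterms[OF ws] dcs_gs
    by (auto simp: leaning_forest_def child_edges_from_append n_def k_def)
  have split: "word_le (us @ vs) ws \<longleftrightarrow> word_le us (word_init k ws) \<and> word_le vs (word_tail k ws)"
    if "dcs ws = dcs us @ dcs vs"
    using append_word_le_iff[OF that] by (simp add: word_init_def word_tail_def k_def)
  show ?thesis
  proof (cases "dcs ws = dcs us @ dcs vs")
    case dcs: True
    note in_words = word_init_tail_in_words[OF ws, of k]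
    show ?thesis
    proof
      assume "word_le (us @ vs) ws \<and>
        forest_le ar (leaning_forest ws) (forest_under (leaning_forest us) (leaning_forest vs))"
      then have low: "word_le us (word_init k ws)" "word_le vs (word_tail k ws)"
        and "list_all2 edge_le (child_edges_from 1 0 1 ws) (child_edges_from 1 0 1 gs)"
        using split[OF dcs] by (auto simp: under le_iff)
      then have E: "list_all2 edge_le (word_edges 1 ws) (word_edges 1 gs)"
        unfolding word_edges_def by (intro edges_le_norm_edge) simp_all
      have "list_all2 edge_le (take k (word_edges 1 ws)) (take k (word_edges 1 gs))"
        using E by (rule list_all2_takeI)
      then have "word_le (word_init k ws) (word_init k gs)"
        using dcs dcs_gs by (simp add: word_le_def word_init_def word_edges_prune_list)
      moreover have "list_all2 edge_le (word_edges (1 + k) (cut_terms_list k ws))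
          (word_edges (1 + k) (cut_terms_list k gs))"
        unfolding word_edges_cut_terms_list[OF order_refl]
        using E by (intro edges_le_norm_edge list_all2_dropI) simp_all
      then have "list_all2 edge_le (word_edges 1 (cut_terms_list k ws))
          (word_edges 1 (cut_terms_list k gs))"
        by (rule word_edges_shift[OF order_refl, THEN iffD1])
      then have "word_le (word_tail k ws) (word_tail k gs)"
        using dcs dcs_gs by (simp add: word_le_def word_tail_def)
      ultimately show "dcs ws = dcs us @ dcs vs \<and> word_init (degs us) ws = us \<and> word_tail (degs us) ws = vs"
        using low dcs word_le_antisym[OF in_words(1) us] word_le_antisym[OF in_words(2) vs]
        unfolding init_gs tail_gs k_def[symmetric] by blast
    next
      assume "dcs ws = dcs us @ dcs vs \<and> word_init (degs us) ws = us \<and> word_tail (degs us) ws = vs"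
      then have init: "word_init k ws = us" and tail: "word_tail k ws = vs" by (auto simp: k_def)
      \<comment> \<open>\<open>ws\<close> is padded to the \<open>n\<close> root children of the
        under product, so that pruning gives equal lists.\<close>
      define cs where "cs = ws @ replicate (n - length ws) Leaf"
      have "length ws \<le> n" using length_words_le[OF ws] dcs by (simp add: n_def k_def)
      moreover have "length us \<le> length ws"
        using arg_cong[OF init, of length] length_filter_le[of "\<lambda>t. t \<noteq> Leaf" "prune_list k ws"]
        by (simp add: word_init_def)
      ultimately have "prune_list k cs = prune_list k gs"
        using prune_list_eq_word_init[OF Leaf_notin_words[OF ws], of k] init
        by (simp add: cs_def prune_list_append prune replicate_add[symmetric])
      moreover have "nonleaf (cut_terms_list k cs) = vs"
        using tail by (simp add: cs_def cut_terms_list_append word_tail_def)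
      ultimately have "list_all2 edge_le (child_edges_from 1 0 1 cs) (child_edges_from 1 0 1 gs)"
        using Leaf_notin_words[OF vs] by (intro greedy_edges_le[OF _ _ cut]) simp_all
      moreover have "word_le (us @ vs) ws"
        using split[OF dcs] init tail by (simp add: word_le_refl)
      ultimately show "word_le (us @ vs) ws \<and>
        forest_le ar (leaning_forest ws) (forest_under (leaning_forest us) (leaning_forest vs))"
        using dcs dcs_gs by (simp add: under le_iff cs_def child_edges_from_append)
    qed
  qed (auto simp: word_le_def)
qed

section \<open>Moebius inversion in locally finite posets\<close>

lemma moebius_self:
  assumes "locally_finite_poset P r" "x \<in> P"
  shows "moebius P r x x = 1"
proof -
  from assms have "(x, x) \<in> r"
    by (auto simp: locally_finite_poset_def partial_order_on_def preorder_on_def dest: refl_onD)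
  with assms show ?thesis by (simp add: moebius.simps)
qed

lemma sum_moebius_left:
  assumes "locally_finite_poset P r" "x \<in> P" "z \<in> P"
  shows "(\<Sum>y\<in>interval P r x z. moebius P r x y) = (if x = z then 1 else 0)"
proof -
  from assms have po: "refl_on P r" "antisym r" "trans r" and fin: "finite (interval P r x z)"
    by (auto simp: locally_finite_poset_def partial_order_on_def preorder_on_def)
  consider "(x, z) \<notin> r" | "x = z" | "(x, z) \<in> r" "x \<noteq> z" by blast
  then show ?thesis
  proof cases
    case 1
    then have "interval P r x z = {}" using po(3) by (auto simp: interval_def dest: transD)
    moreover have "x \<noteq> z" using 1 assms(2) po(1) by (auto dest: refl_onD)
    ultimately show ?thesis by simp
  next
    case 2
    then have "interval P r x z = {x}"
      using po assms(2) by (auto simp: interval_def dest: antisymD refl_onD)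
    then show ?thesis using 2 assms by (simp add: moebius_self)
  next
    case 3
    then have "z \<in> interval P r x z" using po(1) assms by (auto simp: interval_def dest: refl_onD)
    then have "(\<Sum>y\<in>interval P r x z. moebius P r x y) =
      moebius P r x z + (\<Sum>y\<in>interval P r x z - {z}. moebius P r x y)"
      using fin by (rule sum.remove[rotated])
    with 3 assms show ?thesis by (simp add: moebius.simps[of P r x z])
  qed
qed

text \<open>The recursion of \<open>moebius\<close> yields \<open>sum_moebius_left\<close> directly;
  here the one-sided inverse of the zeta function is shown to be two-sided.\<close>

lemma sum_moebius_right:
  assumes "locally_finite_poset P r" "x \<in> P" "z \<in> P"
  shows "(\<Sum>y\<in>interval P r x z. moebius P r y z) = (if x = z then 1 else 0)"
  using assms(2)
proof (induction "card (interval P r x z)" arbitrary: x rule: less_induct)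
  case less
  let ?I = "interval P r" and ?m = "moebius P r"
  from assms(1) have po: "refl_on P r" "antisym r" "trans r"
    by (auto simp: locally_finite_poset_def partial_order_on_def preorder_on_def)
  have fin: "finite (?I a b)" if "a \<in> P" "b \<in> P" for a b
    using assms(1) that by (auto simp: locally_finite_poset_def)
  define g where "g y = (\<Sum>w\<in>?I y z. ?m w z)" for y
  note one = moebius_self[OF assms(1)]
  consider "(x, z) \<notin> r" | "x = z" | "(x, z) \<in> r" "x \<noteq> z" by blast
  then show ?case
  proof cases
    case 1
    then have "?I x z = {}" using po(3) by (auto simp: interval_def dest: transD)
    moreover have "x \<noteq> z" using 1 less.prems po(1) by (auto dest: refl_onD)
    ultimately show ?thesis by simp
  next
    case 2
    then have "?I x z = {x}"
      using po less.prems by (auto simp: interval_def dest: antisymD refl_onD)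
    then show ?thesis using 2 one less.prems by simp
  next
    case 3
    have x: "x \<in> ?I x z" and z: "z \<in> ?I x z"
      using 3 less.prems assms(3) po(1) by (auto simp: interval_def dest: refl_onD)
    have g: "g y = (if y = z then 1 else 0)" if "y \<in> ?I x z - {x}" for y
    proof -
      from that have y: "y \<in> P" "(x, y) \<in> r" "x \<noteq> y" by (auto simp: interval_def)
      then have "?I y z \<subseteq> ?I x z" "x \<notin> ?I y z"
        using po by (auto simp: interval_def dest: transD antisymD)
      with x have "?I y z \<subset> ?I x z" by blast
      then have "card (?I y z) < card (?I x z)"
        using fin less.prems assms(3) by (intro psubset_card_mono) auto
      then show ?thesis unfolding g_def using y(1) by (rule less.hyps)
    qed
    \<comment> \<open>With delta(x, w) expanded by the left identity and the sums exchanged, mu(x,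
      z) becomes the sum of mu(x, y) g(y). By induction this is g(x) + mu(x, z), hence g(x) =
      0.\<close>
    have "?m x z = (\<Sum>w\<in>?I x z. (if x = w then 1 else 0) * ?m w z)"
      using x fin less.prems assms(3) by (simp add: if_distrib[of "\<lambda>c. c * _"] sum.delta cong: if_cong)
    also have "\<dots> = (\<Sum>w\<in>?I x z. \<Sum>y\<in>?I x w. ?m x y * ?m w z)"
      using less.prems sum_moebius_left[OF assms(1)]
      by (intro sum.cong refl) (auto simp: interval_def simp flip: sum_distrib_right)
    also have "\<dots> = (\<Sum>w\<in>?I x z. \<Sum>y | y \<in> ?I x z \<and> w \<in> ?I y z. ?m x y * ?m w z)"
      using po(3) by (intro sum.cong refl) (auto simp: interval_def dest: transD)
    also have "\<dots> = (\<Sum>y\<in>?I x z. \<Sum>w | w \<in> ?I x z \<and> w \<in> ?I y z. ?m x y * ?m w z)"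
      using fin less.prems assms(3) by (intro sum.swap_restrict) auto
    also have "\<dots> = (\<Sum>y\<in>?I x z. ?m x y * g y)"
      unfolding g_def sum_distrib_left
      using po(3) by (intro sum.cong refl) (auto simp: interval_def dest: transD)
    also have "\<dots> = g x + (\<Sum>y\<in>?I x z - {x}. ?m x y * g y)"
      using x fin less.prems assms(3) one by (simp add: sum.remove[of _ x])
    also have "(\<Sum>y\<in>?I x z - {x}. ?m x y * g y) = (\<Sum>y\<in>?I x z - {x}. if y = z then ?m x z else 0)"
      using g by (intro sum.cong refl) auto
    also have "\<dots> = ?m x z"
      using z 3 fin less.prems assms(3) by (simp add: sum.delta)
    finally have "g x = 0" by simp
    with 3 show ?thesis by (simp add: g_def)
  qed
qed

section \<open>The algebra\<close>

text \<open>Discharges the guard in \<open>moebius\<close>, which would otherwise return 0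
  throughout. Intervals are finite because their members share the decorations of the lower
  end.\<close>

lemma locally_finite_leaning: "locally_finite_poset (leaning S ar) (leaning_rel S ar)"
proof -
  let ?P = "leaning S ar" and ?r = "leaning_rel S ar"
  have "refl_on ?P ?r"
    by (auto simp: refl_on_def leaning_rel_def tm_le_def)
  moreover have "trans ?r"
    by (rule transI)
       (auto simp: leaning_rel_def leaning_eq_image forest_le_leaning_forest_iff
          intro: word_le_trans)
  moreover have "antisym ?r"
    by (rule antisymI)
       (auto simp: leaning_rel_def leaning_eq_image forest_le_leaning_forest_iff
          intro!: arg_cong[of _ _ leaning_forest] intro: word_le_antisym)
  moreover have "finite (interval ?P ?r F G)" if "F \<in> ?P" for F G
  proof -
    from that obtain us where us: "us \<in> leaning_words S ar" "F = leaning_forest us"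
      by (auto simp: leaning_eq_image)
    have "interval ?P ?r F G \<subseteq> leaning_forest ` words_with_dc S ar (dcs us)"
      using us by (auto simp: interval_def leaning_rel_def leaning_eq_image words_with_dc_def
          forest_le_leaning_forest_iff word_le_def)
    then show ?thesis by (rule finite_subset) (simp add: finite_words_with_dc)
  qed
  moreover have "?r \<subseteq> ?P \<times> ?P" by (auto simp: leaning_rel_def)
  ultimately show ?thesis
    by (auto simp: locally_finite_poset_def partial_order_on_def preorder_on_def)
qed

definition word_moebius ::
  "'s set \<Rightarrow> ('s \<Rightarrow> nat) \<Rightarrow> ('s + nat) tm list \<Rightarrow> ('s + nat) tm list \<Rightarrow> int" where
  "word_moebius S ar us vs =
     moebius (leaning S ar) (leaning_rel S ar) (leaning_forest us) (leaning_forest vs)"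

lemma word_moebius_eq_0:
  assumes "us \<in> leaning_words S ar" "vs \<in> leaning_words S ar" "\<not> word_le us vs"
  shows "word_moebius S ar us vs = 0"
  using assms
  by (simp add: word_moebius_def moebius.simps leaning_rel_def forest_le_leaning_forest_iff)

lemma interval_leaning_eq_image:
  assumes "us \<in> leaning_words S ar" "ws \<in> words_with_dc S ar d"
  shows "interval (leaning S ar) (leaning_rel S ar) (leaning_forest us) (leaning_forest ws) =
    leaning_forest ` {vs \<in> words_with_dc S ar d. word_le us vs \<and> word_le vs ws}"
  using assms
  by (auto simp: interval_def leaning_rel_def leaning_eq_image words_with_dc_def
      forest_le_leaning_forest_iff word_le_def)

text \<open>Both Moebius identities, moved to words. The sums may run over a whole decoration class
  because \<open>word_moebius\<close> vanishes between unrelated words.\<close>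

lemma
  assumes us: "us \<in> words_with_dc S ar d" and ws: "ws \<in> words_with_dc S ar d"
  shows sum_word_moebius_left:
      "(\<Sum>vs\<in>words_with_dc S ar d. if word_le vs ws then word_moebius S ar us vs else 0) =
        (if us = ws then 1 else 0)"
    and sum_word_moebius_right:
      "(\<Sum>vs\<in>words_with_dc S ar d. if word_le us vs then word_moebius S ar vs ws else 0) =
        (if us = ws then 1 else 0)"
proof -
  let ?I = "{vs \<in> words_with_dc S ar d. word_le us vs \<and> word_le vs ws}"
  from us ws have W: "us \<in> leaning_words S ar" "ws \<in> leaning_words S ar"
    by (auto simp: words_with_dc_def)
  then have L: "leaning_forest us \<in> leaning S ar" "leaning_forest ws \<in> leaning S ar"
    by (auto simp: leaning_eq_image)
  have eq: "leaning_forest us = leaning_forest ws \<longleftrightarrow> us = ws"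
    using inj_on_leaning_forest W by (auto dest: inj_onD)
  have inj: "inj_on leaning_forest ?I"
    by (rule inj_on_subset[OF inj_on_leaning_forest]) (auto simp: words_with_dc_def)
  have "(\<Sum>vs\<in>words_with_dc S ar d. if word_le vs ws then word_moebius S ar us vs else 0) =
    (\<Sum>vs\<in>?I. word_moebius S ar us vs)"
    using W(1) word_moebius_eq_0[of us S ar]
    by (intro sum.mono_neutral_cong_right finite_words_with_dc) (auto simp: words_with_dc_def)
  also have "\<dots> = (if us = ws then 1 else 0)"
    using sum_moebius_left[OF locally_finite_leaning L]
    by (simp add: interval_leaning_eq_image[OF W(1) ws] sum.reindex[OF inj] word_moebius_def eq)
  finally show "(\<Sum>vs\<in>words_with_dc S ar d. if word_le vs ws then word_moebius S ar us vs else 0) =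
        (if us = ws then 1 else 0)" .
  have "(\<Sum>vs\<in>words_with_dc S ar d. if word_le us vs then word_moebius S ar vs ws else 0) =
    (\<Sum>vs\<in>?I. word_moebius S ar vs ws)"
    using W(2) word_moebius_eq_0[of _ S ar ws]
    by (intro sum.mono_neutral_cong_right finite_words_with_dc) (auto simp: words_with_dc_def)
  also have "\<dots> = (if us = ws then 1 else 0)"
    using sum_moebius_right[OF locally_finite_leaning L]
    by (simp add: interval_leaning_eq_image[OF W(1) ws] sum.reindex[OF inj] word_moebius_def eq)
  finally show "(\<Sum>vs\<in>words_with_dc S ar d. if word_le us vs then word_moebius S ar vs ws else 0) =
        (if us = ws then 1 else 0)" .
qed

section \<open>Linear algebra in the two bases\<close>

lemma lookup_scale [simp]: "Poly_Mapping.lookup (scale c x) k = c * Poly_Mapping.lookup x k"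
  by (simp add: scale_def Poly_Mapping.map.rep_eq when_def)

lemma scale_0 [simp]: "scale 0 x = 0" and scale_1 [simp]: "scale 1 x = x"
  by (auto intro!: poly_mapping_eqI)

lemma scale_scale: "scale a (scale b x) = scale (a * b) x"
  by (auto intro!: poly_mapping_eqI)

lemma scale_sum_left: "scale (\<Sum>i\<in>I. a i) x = (\<Sum>i\<in>I. scale (a i) x)"
  by (auto intro!: poly_mapping_eqI simp: lookup_sum sum_distrib_right)

lemma scale_sum_right: "scale c (\<Sum>i\<in>I. x i) = (\<Sum>i\<in>I. scale c (x i))"
  by (auto intro!: poly_mapping_eqI simp: lookup_sum sum_distrib_left)

lemma lookup_sum_E_basis:
  assumes "finite I"
  shows "Poly_Mapping.lookup (\<Sum>i\<in>I. scale (a i) (E_basis i)) k = (if k \<in> I then a k else 0)"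
  using assms by (simp add: lookup_sum E_basis_def lookup_single when_def if_distrib cong: if_cong)

text \<open>\<open>A_mult\<close> ranges over supports, which depend on the coefficients that vanish
  in the field; zero coefficients contribute nothing, so fixed index sets may be used.\<close>

lemma A_mult_sum_E_basis:
  fixes a b :: "('s + nat) tm \<Rightarrow> 'k::field"
  assumes "finite I" "finite J"
  shows "A_mult (\<Sum>i\<in>I. scale (a i) (E_basis i)) (\<Sum>j\<in>J. scale (b j) (E_basis j)) =
    (\<Sum>i\<in>I. \<Sum>j\<in>J. scale (a i * b j) (E_basis (forest_over i j)))"
proof -
  have keys: "Poly_Mapping.keys (\<Sum>i\<in>I. scale (c i) (E_basis i)) = {i \<in> I. c i \<noteq> 0}"
    if "finite I" for I and c :: "('s + nat) tm \<Rightarrow> 'k"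
    using that by (auto simp: in_keys_iff lookup_sum_E_basis split: if_splits)
  have "A_mult (\<Sum>i\<in>I. scale (a i) (E_basis i)) (\<Sum>j\<in>J. scale (b j) (E_basis j)) =
    (\<Sum>i\<in>{i \<in> I. a i \<noteq> 0}. \<Sum>j\<in>{j \<in> J. b j \<noteq> 0}. scale (a i * b j) (E_basis (forest_over i j)))"
    unfolding A_mult_def keys[OF assms(1)] keys[OF assms(2)]
    by (intro sum.cong refl) (simp add: lookup_sum_E_basis assms)
  also have "\<dots> = (\<Sum>i\<in>{i \<in> I. a i \<noteq> 0}. \<Sum>j\<in>J. scale (a i * b j) (E_basis (forest_over i j)))"
    by (intro sum.cong refl sum.mono_neutral_left) (auto simp: assms)
  also have "\<dots> = (\<Sum>i\<in>I. \<Sum>j\<in>J. scale (a i * b j) (E_basis (forest_over i j)))"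
    by (intro sum.mono_neutral_left) (auto simp: assms)
  finally show ?thesis .
qed

lemma F_basis_leaning_forest:
  assumes "us \<in> words_with_dc S ar d"
  shows "F_basis S ar (leaning_forest us) =
    (\<Sum>vs\<in>words_with_dc S ar d.
       scale (of_int (word_moebius S ar us vs)) (E_basis (leaning_forest vs)) :: _ \<Rightarrow>\<^sub>0 'k::field)"
proof -
  let ?I = "{vs \<in> words_with_dc S ar d. word_le us vs}"
  from assms have us: "us \<in> leaning_words S ar" by (auto simp: words_with_dc_def)
  have I: "{F \<in> leaning S ar. forest_le ar (leaning_forest us) F} = leaning_forest ` ?I"
  proof -
    have "vs \<in> words_with_dc S ar d \<longleftrightarrow> vs \<in> leaning_words S ar" if "word_le us vs" for vs
      using that assms by (simp add: word_le_def words_with_dc_def)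
    then have "?I = {vs \<in> leaning_words S ar. word_le us vs}" by blast
    then show ?thesis
      using us by (auto simp: leaning_eq_image forest_le_leaning_forest_iff)
  qed
  have inj: "inj_on leaning_forest ?I"
    by (rule inj_on_subset[OF inj_on_leaning_forest]) (auto simp: words_with_dc_def)
  have "F_basis S ar (leaning_forest us) =
    (\<Sum>vs\<in>?I. scale (of_int (word_moebius S ar us vs)) (E_basis (leaning_forest vs)) :: _ \<Rightarrow>\<^sub>0 'k)"
    unfolding F_basis_def I sum.reindex[OF inj] word_moebius_def comp_def ..
  also have "\<dots> = (\<Sum>vs\<in>words_with_dc S ar d.
      scale (of_int (word_moebius S ar us vs)) (E_basis (leaning_forest vs)))"
  proof (intro sum.mono_neutral_left finite_words_with_dc ballI)
    fix vs assume "vs \<in> words_with_dc S ar d - ?I"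
    then have "word_moebius S ar us vs = 0"
      using us by (intro word_moebius_eq_0) (auto simp: words_with_dc_def)
    then show "scale (of_int (word_moebius S ar us vs)) (E_basis (leaning_forest vs)) = 0" by simp
  qed auto
  finally show ?thesis .
qed

text \<open>Expanding the fundamental basis and exchanging the sums leaves the right Moebius
  identity.\<close>

lemma E_basis_leaning_forest:
  assumes "us \<in> words_with_dc S ar d"
  shows "E_basis (leaning_forest us) =
    (\<Sum>vs\<in>words_with_dc S ar d.
       scale (of_bool (word_le us vs)) (F_basis S ar (leaning_forest vs)) :: _ \<Rightarrow>\<^sub>0 'k::field)"
proof -
  let ?W = "words_with_dc S ar d" and ?m = "word_moebius S ar"
  have "(\<Sum>vs\<in>?W. scale (of_bool (word_le us vs)) (F_basis S ar (leaning_forest vs)) :: _ \<Rightarrow>\<^sub>0 'k) =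
    (\<Sum>vs\<in>?W. \<Sum>ws\<in>?W.
      scale (of_int (if word_le us vs then ?m vs ws else 0)) (E_basis (leaning_forest ws)))"
    by (intro sum.cong refl)
       (simp add: F_basis_leaning_forest[of _ S ar d] scale_sum_right scale_scale)
  also have "\<dots> = (\<Sum>ws\<in>?W. scale (of_int (\<Sum>vs\<in>?W. if word_le us vs then ?m vs ws else 0))
      (E_basis (leaning_forest ws)))"
    unfolding of_int_sum scale_sum_left by (rule sum.swap)
  also have "\<dots> = (\<Sum>ws\<in>?W. if us = ws then E_basis (leaning_forest ws) else 0)"
    by (intro sum.cong refl) (simp add: sum_word_moebius_right[OF assms] del: of_int_sum)
  also have "\<dots> = E_basis (leaning_forest us)"
    using assms by (simp add: finite_words_with_dc)
  finally show ?thesis by simp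
qed

theorem theorem5p3p1:
  fixes S :: "'s set" and ar :: "'s \<Rightarrow> nat"
    and F1 F2 :: "('s + nat) tm"
  assumes "F1 \<in> leaning S ar" and "F2 \<in> leaning S ar"
  shows "A_mult (F_basis S ar F1) (F_basis S ar F2) =
    (\<Sum>F\<in>{F \<in> leaning S ar. forest_le ar (forest_over F1 F2) F \<and> forest_le ar F (forest_under F1 F2)}.
       (F_basis S ar F :: ('s + nat) tm \<Rightarrow>\<^sub>0 'k::field))"
proof -
  from assms obtain us vs where us: "us \<in> leaning_words S ar" "F1 = leaning_forest us"
    and vs: "vs \<in> leaning_words S ar" "F2 = leaning_forest vs"
    by (auto simp: leaning_eq_image)
  define d1 where "d1 = dcs us"
  define d2 where "d2 = dcs vs"
  define k where "k = length d1"
  let ?U = "words_with_dc S ar d1" and ?V = "words_with_dc S ar d2"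
    and ?W = "words_with_dc S ar (d1 @ d2)" and ?m = "word_moebius S ar"
  define E where "E ws = (E_basis (leaning_forest ws) :: ('s + nat) tm \<Rightarrow>\<^sub>0 'k)" for ws
  define B where "B ws = (F_basis S ar (leaning_forest ws) :: ('s + nat) tm \<Rightarrow>\<^sub>0 'k)" for ws
  \<comment> \<open>\<open>us' @ vs'\<close> lies below \<open>ws\<close> iff \<open>us'\<close> and
    \<open>vs'\<close> lie below its two parts, so each contribution to the coefficient of
    \<open>B ws\<close> splits into the factors \<open>c1\<close> and \<open>c2\<close>.\<close>
  define c1 where "c1 us' ws = (of_int (if word_le us' (word_init k ws) then ?m us us' else 0) :: 'k)"
    for us' ws
  define c2 where "c2 vs' ws = (of_int (if word_le vs' (word_tail k ws) then ?m vs vs' else 0) :: 'k)"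
    for vs' ws
  have usU: "us \<in> ?U" and vsV: "vs \<in> ?V" using us vs by (auto simp: words_with_dc_def d1_def d2_def)
  have inj: "inj_on leaning_forest (words_with_dc S ar d)" for d
    by (rule inj_on_subset[OF inj_on_leaning_forest]) (auto simp: words_with_dc_def)
  have F_sum: "F_basis S ar (leaning_forest x) =
      (\<Sum>F\<in>leaning_forest ` words_with_dc S ar d.
        scale (of_int (moebius (leaning S ar) (leaning_rel S ar) (leaning_forest x) F)) (E_basis F) :: _ \<Rightarrow>\<^sub>0 'k)"
    if "x \<in> words_with_dc S ar d" for x d
    unfolding F_basis_leaning_forest[OF that] sum.reindex[OF inj] comp_def word_moebius_def ..
  have over: "forest_over (leaning_forest us') (leaning_forest vs') = leaning_forest (us' @ vs')"
    if "us' \<in> ?U" "vs' \<in> ?V" for us' vs'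
    using that by (auto simp: words_with_dc_def intro: forest_over_leaning_forest)
  have "A_mult (B us) (B vs) =
    (\<Sum>us'\<in>?U. \<Sum>vs'\<in>?V. scale (of_int (?m us us') * of_int (?m vs vs'))
       (E_basis (forest_over (leaning_forest us') (leaning_forest vs'))))"
    unfolding B_def F_sum[OF usU] F_sum[OF vsV]
    by (subst A_mult_sum_E_basis)
       (simp_all only: finite_imageI finite_words_with_dc sum.reindex[OF inj] comp_def
          word_moebius_def)
  also have "\<dots> =
    (\<Sum>us'\<in>?U. \<Sum>vs'\<in>?V. scale (of_int (?m us us') * of_int (?m vs vs')) (E (us' @ vs')))"
    unfolding E_def by (intro sum.cong refl) (simp only: over)
  \<comment> \<open>Each \<open>E (us' @ vs')\<close> is expanded back into the fundamental basis
    over the words above it.\<close>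
  also have "\<dots> = (\<Sum>us'\<in>?U. \<Sum>vs'\<in>?V. \<Sum>ws\<in>?W. scale (c1 us' ws * c2 vs' ws) (B ws))"
  proof (intro sum.cong refl)
    fix us' vs' assume *: "us' \<in> ?U" "vs' \<in> ?V"
    then have "us' @ vs' \<in> ?W" by (auto simp: words_with_dc_def)
    then have "E (us' @ vs') = (\<Sum>ws\<in>?W. scale (of_bool (word_le (us' @ vs') ws)) (B ws))"
      unfolding E_def B_def by (rule E_basis_leaning_forest)
    also have "\<dots> = (\<Sum>ws\<in>?W. scale (of_bool (word_le us' (word_init k ws) \<and>
        word_le vs' (word_tail k ws))) (B ws))"
      using append_word_le_iff_init_tail[OF *] by (intro sum.cong refl) (simp add: k_def)
    finally show "scale (of_int (?m us us') * of_int (?m vs vs')) (E (us' @ vs')) =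
        (\<Sum>ws\<in>?W. scale (c1 us' ws * c2 vs' ws) (B ws))"
      by (auto simp: scale_sum_right scale_scale c1_def c2_def intro!: sum.cong)
  qed
  also have "\<dots> = (\<Sum>us'\<in>?U. \<Sum>ws\<in>?W. \<Sum>vs'\<in>?V. scale (c1 us' ws * c2 vs' ws) (B ws))"
    by (intro sum.cong refl sum.swap)
  also have "\<dots> = (\<Sum>ws\<in>?W. \<Sum>us'\<in>?U. \<Sum>vs'\<in>?V. scale (c1 us' ws * c2 vs' ws) (B ws))"
    by (rule sum.swap)
  also have "\<dots> = (\<Sum>ws\<in>?W. scale ((\<Sum>us'\<in>?U. c1 us' ws) * (\<Sum>vs'\<in>?V. c2 vs' ws)) (B ws))"
    by (simp add: sum_product scale_sum_left)
  \<comment> \<open>Both factors are left Moebius sums: each is 1 if the corresponding part of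
    \<open>ws\<close> is \<open>us\<close> or \<open>vs\<close>, and 0 otherwise.\<close>
  also have "\<dots> = (\<Sum>ws\<in>?W. if us = word_init k ws \<and> vs = word_tail k ws then B ws else 0)"
  proof (intro sum.cong refl)
    fix ws assume "ws \<in> ?W"
    note in_words = word_init_tail_in_words_with_dc[OF this, folded k_def]
    have "(\<Sum>us'\<in>?U. c1 us' ws) = of_int (if us = word_init k ws then 1 else 0)"
      unfolding c1_def of_int_sum[symmetric] sum_word_moebius_left[OF usU in_words(1)] ..
    moreover have "(\<Sum>vs'\<in>?V. c2 vs' ws) = of_int (if vs = word_tail k ws then 1 else 0)"
      unfolding c2_def of_int_sum[symmetric] sum_word_moebius_left[OF vsV in_words(2)] ..
    ultimately show "scale ((\<Sum>us'\<in>?U. c1 us' ws) * (\<Sum>vs'\<in>?V. c2 vs' ws)) (B ws) =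
        (if us = word_init k ws \<and> vs = word_tail k ws then B ws else 0)" by simp
  qed
  also have "\<dots> = (\<Sum>ws\<in>{ws \<in> ?W. us = word_init k ws \<and> vs = word_tail k ws}. B ws)"
    by (intro sum.inter_filter[symmetric] finite_words_with_dc)
  \<comment> \<open>The surviving words are those between over and under, by
    \<open>interval_iff_init_tail\<close>.\<close>
  also have "{ws \<in> ?W. us = word_init k ws \<and> vs = word_tail k ws} =
    {ws \<in> leaning_words S ar. word_le (us @ vs) ws \<and> forest_le ar (leaning_forest ws) (forest_under F1 F2)}"
    (is "?L = ?R")
  proof (rule set_eqI)
    fix ws
    show "ws \<in> ?L \<longleftrightarrow> ws \<in> ?R"
    proof (cases "ws \<in> leaning_words S ar")
      case True
      have "ws \<in> ?L \<longleftrightarrow> dcs ws = dcs us @ dcs vs \<and>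
          word_init (degs us) ws = us \<and> word_tail (degs us) ws = vs"
        using True by (simp only: words_with_dc_def mem_Collect_eq d1_def d2_def k_def) metis
      then show ?thesis
        using True interval_iff_init_tail[OF us(1) vs(1) True]
        by (simp only: mem_Collect_eq us(2) vs(2) simp_thms)
    qed (simp add: words_with_dc_def)
  qed
  also have "(\<Sum>ws\<in>\<dots>. B ws) = (\<Sum>F\<in>leaning_forest ` \<dots>. F_basis S ar F)"
    unfolding B_def
    by (rule sum.reindex_cong[symmetric, OF inj_on_subset[OF inj_on_leaning_forest]]) auto
  also have "leaning_forest ` {ws \<in> leaning_words S ar. word_le (us @ vs) ws \<and>
      forest_le ar (leaning_forest ws) (forest_under F1 F2)} =
    {F \<in> leaning S ar. forest_le ar (forest_over F1 F2) F \<and> forest_le ar F (forest_under F1 F2)}"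
    using us vs forest_over_leaning_forest[OF us(1) vs(1)]
    by (auto simp: leaning_eq_image forest_le_leaning_forest_iff)
  finally show ?thesis by (simp add: B_def us(2) vs(2))
qed

end
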